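(* Let $H$ be a separable Hilbert space, $\varphi^n,\varphi:H\to[0,+\infty]$ proper, l.s.c., convex functionals, and $(\Omega,\mathcal A,\mu)$ a complete, totally $\sigma$-finite measure space. For $u\in L^2(\Omega,\mu;H)$ put $\bar\varphi(u)=\int_\Omega\varphi(u(\omega))\,\mu(d\omega)$ and $\bar\varphi^n(u)=\int_\Omega\varphi^n(u(\omega))\,\mu(d\omega)$. Suppose that either condition (N) holds for $\bar\varphi^n,\bar\varphi$ on $L^2(\Omega,\mu;H)$, or $\mu$ is a finite measure. If $\varphi^n\to\varphi$ in Mosco sense on $H$, then $\bar\varphi^n\to\bar\varphi$ in Mosco sense on $L^2(\Omega,\mu;H)$.
   Context: Mosco convergence on a Hilbert space $E$: $\psi^n\to\psi$ if (a) for every sequence $u^n\rightharpoonup u$ weakly in $E$, $\liminf_n\psi^n(u^n)\ge\psi(u)$, and (b) for every $v\in E$ there are $v^n\to v$ strongly in $E$ with $\limsup_n\psi^n(v^n)\le\psi(v)$. Condition (N) for proper convex l.s.c. $\psi^n,\psi$ on a Hilbert space $E$: there exist $(u^n,v^n)\in E\times E$ with $v^n\in\partial\psi^n(u^n)$ for all $n$ and $(u,v)\in E\times E$ with $v\in\partial\psi(u)$ such that $u^n\to u$ and $v^n\to v$ strongly in $E$. Here $\partial$ denotes the subdifferential. *)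

theory Defs
  imports "HOL-Analysis.Analysis"
begin

definition proper_fun :: "('a \<Rightarrow> ennreal) \<Rightarrow> bool" where
  "proper_fun \<psi> \<longleftrightarrow> (\<exists>x. \<psi> x \<noteq> \<infinity>)"

definition lsc_fun :: "('a::topological_space \<Rightarrow> ennreal) \<Rightarrow> bool" where
  "lsc_fun \<psi> \<longleftrightarrow> (\<forall>c. closed {x. \<psi> x \<le> c})"

definition convex_fun :: "('a::real_vector \<Rightarrow> ennreal) \<Rightarrow> bool" where
  "convex_fun \<psi> \<longleftrightarrow> (\<forall>x y t. 0 < t \<and> t < 1 \<longrightarrow>
      \<psi> (t *\<^sub>R x + (1 - t) *\<^sub>R y) \<le> ennreal t * \<psi> x + ennreal (1 - t) * \<psi> y)"

text \<open>A (pre-)Hilbert space is given abstractly by a carrier S and an inner product ip on it.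
  Weak and strong convergence of sequences in S.\<close>

definition weak_conv :: "'a set \<Rightarrow> ('a \<Rightarrow> 'a \<Rightarrow> real) \<Rightarrow> (nat \<Rightarrow> 'a) \<Rightarrow> 'a \<Rightarrow> bool" where
  "weak_conv S ip x y \<longleftrightarrow> (\<forall>v\<in>S. (\<lambda>n. ip (x n) v) \<longlonglongrightarrow> ip y v)"

definition strong_conv :: "'a set \<Rightarrow> ('a::minus \<Rightarrow> 'a \<Rightarrow> real) \<Rightarrow> (nat \<Rightarrow> 'a) \<Rightarrow> 'a \<Rightarrow> bool" where
  "strong_conv S ip x y \<longleftrightarrow> (\<lambda>n. ip (x n - y) (x n - y)) \<longlonglongrightarrow> 0"

definition mosco :: "'a set \<Rightarrow> ('a::minus \<Rightarrow> 'a \<Rightarrow> real) \<Rightarrow> (nat \<Rightarrow> 'a \<Rightarrow> ennreal) \<Rightarrow> ('a \<Rightarrow> ennreal) \<Rightarrow> bool" where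
  "mosco S ip \<psi>s \<psi> \<longleftrightarrow>
     (\<forall>u us. (\<forall>n. us n \<in> S) \<and> u \<in> S \<and> weak_conv S ip us u \<longrightarrow>
        liminf (\<lambda>n. \<psi>s n (us n)) \<ge> \<psi> u) \<and>
     (\<forall>v\<in>S. \<exists>vs. (\<forall>n. vs n \<in> S) \<and> strong_conv S ip vs v \<and>
        limsup (\<lambda>n. \<psi>s n (vs n)) \<le> \<psi> v)"

definition subdiff :: "'a set \<Rightarrow> ('a::minus \<Rightarrow> 'a \<Rightarrow> real) \<Rightarrow> ('a \<Rightarrow> ennreal) \<Rightarrow> 'a \<Rightarrow> 'a set" where
  "subdiff S ip \<psi> u = {v\<in>S. u \<in> S \<and> \<psi> u \<noteq> \<infinity> \<and>
      (\<forall>w\<in>S. enn2ereal (\<psi> w) \<ge> enn2ereal (\<psi> u) + ereal (ip v (w - u)))}"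

definition condition_N :: "'a set \<Rightarrow> ('a::minus \<Rightarrow> 'a \<Rightarrow> real) \<Rightarrow> (nat \<Rightarrow> 'a \<Rightarrow> ennreal) \<Rightarrow> ('a \<Rightarrow> ennreal) \<Rightarrow> bool" where
  "condition_N S ip \<psi>s \<psi> \<longleftrightarrow>
     (\<exists>us vs u v. (\<forall>n. us n \<in> S \<and> vs n \<in> subdiff S ip (\<psi>s n) (us n)) \<and>
        u \<in> S \<and> v \<in> subdiff S ip \<psi> u \<and>
        strong_conv S ip us u \<and> strong_conv S ip vs v)"

definition L2 :: "'w measure \<Rightarrow> ('w \<Rightarrow> 'h::{real_inner,banach,second_countable_topology}) set" where
  "L2 M = {u. u \<in> borel_measurable M \<and> integrable M (\<lambda>\<omega>. (norm (u \<omega>))\<^sup>2)}"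

definition L2_inner :: "'w measure \<Rightarrow> ('w \<Rightarrow> 'h::{real_inner,banach,second_countable_topology}) \<Rightarrow> ('w \<Rightarrow> 'h) \<Rightarrow> real" where
  "L2_inner M u v = (\<integral>\<omega>. inner (u \<omega>) (v \<omega>) \<partial>M)"

definition lift_fun :: "'w measure \<Rightarrow> ('h \<Rightarrow> ennreal) \<Rightarrow> ('w \<Rightarrow> 'h) \<Rightarrow> ennreal" where
  "lift_fun M \<psi> u = (\<integral>\<^sup>+ \<omega>. \<psi> (u \<omega>) \<partial>M)"

end

theory Submission
  imports Defs
begin

text \<open>
  Averaging over the cells of a countable measurable partition into sets of finite measure reduces
  everything to Mosco convergence in \<open>H\<close>. By Jensen's inequality averaging does not increase the
  integral functionals, and on each cell it turns weak convergence in \<open>L2\<close> into weak convergence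
  in \<open>H\<close>; the liminf inequality then follows from Fatou's lemma, first for the averages of the
  limit \<open>u\<close> and, refining the partition, for \<open>u\<close> itself. For the recovery sequence, \<open>v\<close> is
  approximated by averages on finitely many cells, extended by a constant \<open>z\<close>, and the finitely many
  values are recovered separately in \<open>H\<close>. On a space of infinite measure a nonnegative lower
  semicontinuous \<open>\<psi>\<close> with \<open>\<integral>\<psi>(u) < \<infinity>\<close> for some \<open>u\<close> in \<open>L2\<close> vanishes at \<open>0\<close>, so condition (N)
  allows \<open>z = 0\<close> with the constant recovery sequence \<open>0\<close>.
\<close>

section \<open>Lower semicontinuity and convexity of extended-valued functionals\<close>

lemma lsc_fun_measurable:
  fixes \<psi> :: "'a::topological_space \<Rightarrow> ennreal"
  assumes "lsc_fun \<psi>"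
  shows "\<psi> \<in> borel_measurable borel"
  by (rule borel_measurableI_le) (use assms in \<open>auto simp: lsc_fun_def intro: borel_closed\<close>)

lemma lsc_fun_measurable_compose:
  fixes \<psi> :: "'a::topological_space \<Rightarrow> ennreal"
  assumes "lsc_fun \<psi>" "f \<in> borel_measurable M"
  shows "(\<lambda>x. \<psi> (f x)) \<in> borel_measurable M"
  using measurable_compose[OF assms(2) lsc_fun_measurable[OF assms(1)]] .

lemma lsc_fun_eventually_gt:
  assumes "lsc_fun \<psi>" "c < \<psi> a" "(x \<longlongrightarrow> a) F"
  shows "eventually (\<lambda>n. c < \<psi> (x n)) F"
proof -
  have "open (- {x. \<psi> x \<le> c})" "a \<in> - {x. \<psi> x \<le> c}"
    using assms(1,2) by (auto simp: lsc_fun_def)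
  then have "eventually (\<lambda>n. x n \<in> - {x. \<psi> x \<le> c}) F"
    using assms(3) topological_tendstoD by blast
  then show ?thesis by eventually_elim auto
qed

lemma lsc_fun_Liminf:
  assumes "lsc_fun \<psi>" "(x \<longlongrightarrow> a) F"
  shows "\<psi> a \<le> Liminf F (\<lambda>n. \<psi> (x n))"
  using lsc_fun_eventually_gt[OF assms(1) _ assms(2)] by (auto simp: le_Liminf_iff)

lemma lsc_fun_ball:
  fixes a :: "'a::metric_space"
  assumes "lsc_fun \<psi>" "c < \<psi> a"
  obtains r where "r > 0" "\<And>x. dist x a < r \<Longrightarrow> c < \<psi> x"
proof -
  have "open (- {x. \<psi> x \<le> c})" "a \<in> - {x. \<psi> x \<le> c}"
    using assms by (auto simp: lsc_fun_def)
  then show ?thesis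
    unfolding open_dist using that by (metis ComplD mem_Collect_eq not_le ComplI)
qed

lemma convex_fun_enn2real:
  assumes "convex_fun \<psi>" "\<psi> x \<noteq> \<infinity>" "\<psi> y \<noteq> \<infinity>" "0 < t" "t < 1"
  shows "\<psi> (t *\<^sub>R x + (1 - t) *\<^sub>R y) \<noteq> \<infinity>"
    and "enn2real (\<psi> (t *\<^sub>R x + (1 - t) *\<^sub>R y)) \<le> t * enn2real (\<psi> x) + (1 - t) * enn2real (\<psi> y)"
proof -
  have "\<psi> (t *\<^sub>R x + (1 - t) *\<^sub>R y) \<le> ennreal t * \<psi> x + ennreal (1 - t) * \<psi> y"
    using assms unfolding convex_fun_def by blast
  also have "\<dots> = ennreal (t * enn2real (\<psi> x) + (1 - t) * enn2real (\<psi> y))"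
    using assms by (cases "\<psi> x"; cases "\<psi> y") (auto simp: ennreal_mult)
  finally have *: "\<psi> (t *\<^sub>R x + (1 - t) *\<^sub>R y) \<le> ennreal (t * enn2real (\<psi> x) + (1 - t) * enn2real (\<psi> y))" .
  then show "\<psi> (t *\<^sub>R x + (1 - t) *\<^sub>R y) \<noteq> \<infinity>"
    using neq_top_trans by (metis ennreal_neq_top infinity_ennreal_def)
  show "enn2real (\<psi> (t *\<^sub>R x + (1 - t) *\<^sub>R y)) \<le> t * enn2real (\<psi> x) + (1 - t) * enn2real (\<psi> y)"
    using * assms by (intro enn2real_leI) auto
qed

section \<open>Proximal points and affine minorants\<close>

text \<open>The quadratic term makes the convex objective strongly convex, so a minimizing sequence
  is Cauchy in norm. Completeness gives its limit, and lower semicontinuity shows that the limit is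
  a minimizer.\<close>

lemma proximal_point_exists:
  fixes \<psi> :: "'h::{real_inner,banach} \<Rightarrow> ennreal"
  assumes proper: "proper_fun \<psi>" and lsc: "lsc_fun \<psi>" and conv: "convex_fun \<psi>" and \<kappa>: "\<kappa> > 0"
  obtains y where "\<psi> y \<noteq> \<infinity>"
    "\<And>w. \<psi> w \<noteq> \<infinity> \<Longrightarrow>
      enn2real (\<psi> y) + \<kappa> * (norm (y - a))\<^sup>2 \<le> enn2real (\<psi> w) + \<kappa> * (norm (w - a))\<^sup>2"
proof -
  \<comment> \<open>\<open>enn2real\<close> sends infinity to 0, so the minimization has to be
    confined to the effective domain.\<close>
  define D where "D = {y. \<psi> y \<noteq> \<infinity>}"
  define F where "F y = enn2real (\<psi> y) + \<kappa> * (norm (y - a))\<^sup>2" for y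
  define m where "m = Inf (F ` D)"
  have D: "D \<noteq> {}"
    using proper by (auto simp: D_def proper_fun_def)
  have F0: "F y \<ge> 0" for y
    using \<kappa> by (simp add: F_def)
  have m_le: "m \<le> F y" if "y \<in> D" for y
    unfolding m_def by (rule cINF_lower[OF _ that]) (auto intro!: bdd_belowI2[of _ 0] F0)
  have "\<exists>y\<in>D. F y < m + 1 / Suc n" for n
    using cInf_lessD[of "F ` D" "m + 1 / Suc n"] D by (auto simp: m_def)
  then obtain y where y: "\<And>n. y n \<in> D" "\<And>n. F (y n) < m + 1 / Suc n"
    by metis
  \<comment> \<open>Compare \<open>m\<close> with the value at the midpoint: convexity controls the
    \<open>\<psi>\<close> term, and the parallelogram identity yields a gain of
    \<open>\<kappa> / 4\<close> times the squared distance.\<close>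
  have mid: "\<kappa> * (dist (y i) (y j))\<^sup>2 \<le> 2 * (1 / Suc i + 1 / Suc j)" for i j
  proof -
    let ?z = "(1/2) *\<^sub>R y i + (1 - 1/2) *\<^sub>R y j"
    have "?z \<in> D" "enn2real (\<psi> ?z) \<le> 1/2 * enn2real (\<psi> (y i)) + (1 - 1/2) * enn2real (\<psi> (y j))"
      using convex_fun_enn2real[OF conv, of "y i" "y j" "1/2"] y by (auto simp: D_def)
    moreover
    have "(norm (?z - a))\<^sup>2 = 1/2 * (norm (y i - a))\<^sup>2 + 1/2 * (norm (y j - a))\<^sup>2 - 1/4 * (dist (y i) (y j))\<^sup>2"
      unfolding dist_norm power2_norm_eq_inner
      by (simp add: inner_simps inner_commute field_simps)
    then have "\<kappa> * (norm (?z - a))\<^sup>2 = 1/2 * (\<kappa> * (norm (y i - a))\<^sup>2) + 1/2 * (\<kappa> * (norm (y j - a))\<^sup>2) - \<kappa> * (1/4 * (dist (y i) (y j))\<^sup>2)"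
      by (metis (no_types, lifting) mult.left_commute right_diff_distrib distrib_left)
    ultimately have "m \<le> 1/2 * F (y i) + 1/2 * F (y j) - \<kappa> * (1/4 * (dist (y i) (y j))\<^sup>2)"
      using m_le[of ?z] unfolding F_def by argo
    then show ?thesis
      using y(2)[of i] y(2)[of j] by simp
  qed
  have "Cauchy y"
  proof (rule metric_CauchyI)
    fix e :: real assume "e > 0"
    then have "\<kappa> * e\<^sup>2 / 4 > 0" using \<kappa> by simp
    then obtain N where N: "1 / real (Suc N) < \<kappa> * e\<^sup>2 / 4"
      using reals_Archimedean[of "\<kappa> * e\<^sup>2 / 4"] by (auto simp: inverse_eq_divide)
    have "dist (y i) (y j) < e" if "i \<ge> N" "j \<ge> N" for i j
    proof -
      have "1 / real (Suc i) \<le> 1 / real (Suc N)" "1 / real (Suc j) \<le> 1 / real (Suc N)"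
        using that by (auto intro!: divide_left_mono)
      then have "\<kappa> * (dist (y i) (y j))\<^sup>2 < \<kappa> * e\<^sup>2"
        using mid[of i j] N by argo
      then show ?thesis
        using \<kappa> \<open>e > 0\<close> by (simp add: power_less_imp_less_base)
    qed
    then show "\<exists>N. \<forall>i\<ge>N. \<forall>j\<ge>N. dist (y i) (y j) < e" by blast
  qed
  then obtain p where p: "y \<longlonglongrightarrow> p"
    using Cauchy_convergent convergent_def by blast
  have "(\<lambda>n. m + 1 / Suc n) \<longlonglongrightarrow> m + 0"
    by (intro tendsto_add tendsto_const LIMSEQ_Suc[OF lim_1_over_n])
  then have "(\<lambda>n. F (y n)) \<longlonglongrightarrow> m"
    using m_le[OF y(1)] y(2)
    by (intro tendsto_sandwich[OF _ _ tendsto_const, of m "\<lambda>n. F (y n)" sequentially "\<lambda>n. m + 1 / Suc n"])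
      (auto intro!: always_eventually less_imp_le)
  \<comment> \<open>Removing the convergent quadratic term leaves convergence of the
    \<open>\<psi>\<close> values alone, to which lower semicontinuity applies.\<close>
  then have "(\<lambda>n. F (y n) - \<kappa> * (norm (y n - a))\<^sup>2) \<longlonglongrightarrow> m - \<kappa> * (norm (p - a))\<^sup>2"
    by (intro tendsto_intros p)
  then have lim: "(\<lambda>n. enn2real (\<psi> (y n))) \<longlonglongrightarrow> m - \<kappa> * (norm (p - a))\<^sup>2"
    by (simp add: F_def)
  then have "(\<lambda>n. ennreal (enn2real (\<psi> (y n)))) \<longlonglongrightarrow> ennreal (m - \<kappa> * (norm (p - a))\<^sup>2)"
    by (rule tendsto_ennrealI)
  then have "liminf (\<lambda>n. \<psi> (y n)) = ennreal (m - \<kappa> * (norm (p - a))\<^sup>2)"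
    using y(1) by (intro lim_imp_Liminf) (auto simp: D_def less_top)
  then have le: "\<psi> p \<le> ennreal (m - \<kappa> * (norm (p - a))\<^sup>2)"
    using lsc_fun_Liminf[OF lsc p] by simp
  have "m - \<kappa> * (norm (p - a))\<^sup>2 \<ge> 0"
    using LIMSEQ_le_const[OF lim, of 0] by simp
  then have "F p \<le> m"
    using enn2real_leI[OF _ le] by (simp add: F_def)
  moreover have "\<psi> p \<noteq> \<infinity>"
    using le neq_top_trans by (metis ennreal_neq_top infinity_ennreal_def)
  ultimately show ?thesis
    using that[of p] m_le by (force simp: D_def F_def)
qed

text \<open>Separation in proximal form: optimality of the proximal point \<open>y\<close> of
  \<open>a\<close> makes \<open>2 * \<kappa> * (a - y)\<close> a subgradient of
  \<open>\<psi>\<close> at \<open>y\<close>, and \<open>b\<close> is the value at \<open>a\<close>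
  of the affine function supporting \<open>\<psi>\<close> there. Negative values of the minorant are
  truncated to 0 by \<open>ennreal\<close>, which is harmless because \<open>\<psi>\<close> is
  nonnegative.\<close>

lemma affine_minorant:
  fixes \<psi> :: "'h::{real_inner,banach} \<Rightarrow> ennreal"
  assumes proper: "proper_fun \<psi>" and lsc: "lsc_fun \<psi>" and conv: "convex_fun \<psi>"
    and c: "ennreal c < \<psi> a" "c \<ge> 0"
  obtains b p where "c \<le> b" "\<And>w. ennreal (b + inner p (w - a)) \<le> \<psi> w"
proof -
  obtain r where r: "r > 0" "\<And>x. dist x a < r \<Longrightarrow> ennreal c < \<psi> x"
    using lsc_fun_ball[OF lsc c(1)] by blast
  \<comment> \<open>The penalty ensures that \<open>b\<close> reaches \<open>c\<close> in both
    cases: within distance \<open>r\<close> of \<open>a\<close> the value \<open>\<psi> y\<close>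
    already exceeds \<open>c\<close>, and farther away the quadratic part of \<open>b\<close> is at
    least \<open>\<kappa> * r^2 = c + 1\<close>.\<close>
  define \<kappa> where "\<kappa> = (c + 1) / r\<^sup>2"
  have \<kappa>: "\<kappa> > 0" using r c by (simp add: \<kappa>_def)
  obtain y where y: "\<psi> y \<noteq> \<infinity>"
    "\<And>w. \<psi> w \<noteq> \<infinity> \<Longrightarrow>
      enn2real (\<psi> y) + \<kappa> * (norm (y - a))\<^sup>2 \<le> enn2real (\<psi> w) + \<kappa> * (norm (w - a))\<^sup>2"
    using proximal_point_exists[OF proper lsc conv \<kappa>] by blast
  \<comment> \<open>First-order optimality: compare \<open>y\<close> with the point at parameter
    \<open>t\<close> on the segment towards \<open>w\<close>, divide by \<open>t\<close>, and let
    \<open>t\<close> decrease to 0.\<close>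
  have sub: "enn2real (\<psi> y) \<le> enn2real (\<psi> w) + 2 * \<kappa> * inner (y - a) (w - y)" if w: "\<psi> w \<noteq> \<infinity>" for w
  proof -
    have "enn2real (\<psi> y) \<le> enn2real (\<psi> w) + 2 * \<kappa> * inner (y - a) (w - y) + t * (\<kappa> * (norm (w - y))\<^sup>2)"
      if t: "0 < t" "t < 1" for t
    proof -
      let ?z = "t *\<^sub>R w + (1 - t) *\<^sub>R y"
      have "(norm (?z - a))\<^sup>2 = (norm ((y - a) + t *\<^sub>R (w - y)))\<^sup>2"
        by (simp add: algebra_simps)
      also have "\<dots> = (norm (y - a))\<^sup>2 + 2 * t * inner (y - a) (w - y) + t\<^sup>2 * (norm (w - y))\<^sup>2"
        unfolding power2_norm_eq_inner
        by (simp add: inner_add_left inner_add_right inner_commute[of "w - y" "y - a"] power2_eq_square distrib_left)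
      finally have n: "(norm (?z - a))\<^sup>2 = (norm (y - a))\<^sup>2 + 2 * t * inner (y - a) (w - y) + t\<^sup>2 * (norm (w - y))\<^sup>2" .
      have "enn2real (\<psi> y) + \<kappa> * (norm (y - a))\<^sup>2 \<le> t * enn2real (\<psi> w) + (1 - t) * enn2real (\<psi> y) + \<kappa> * (norm (?z - a))\<^sup>2"
        using convex_fun_enn2real[OF conv w y(1) t] y(2)[of ?z] by linarith
      then have "t * enn2real (\<psi> y) \<le> t * (enn2real (\<psi> w) + 2 * \<kappa> * inner (y - a) (w - y) + t * (\<kappa> * (norm (w - y))\<^sup>2))"
        unfolding n by (simp add: algebra_simps power2_eq_square)
      then show ?thesis using t by simp
    qed
    then have "eventually (\<lambda>t. enn2real (\<psi> y) \<le> enn2real (\<psi> w) + 2 * \<kappa> * inner (y - a) (w - y) + t * (\<kappa> * (norm (w - y))\<^sup>2)) (at_right 0)"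
      using eventually_at_right_field[of _ "0::real"] zero_less_one by blast
    moreover have "((\<lambda>t. enn2real (\<psi> w) + 2 * \<kappa> * inner (y - a) (w - y) + t * (\<kappa> * (norm (w - y))\<^sup>2)) \<longlongrightarrow>
        enn2real (\<psi> w) + 2 * \<kappa> * inner (y - a) (w - y) + 0 * (\<kappa> * (norm (w - y))\<^sup>2)) (at_right 0)"
      by (intro tendsto_intros)
    ultimately show ?thesis
      using tendsto_lowerbound by fastforce
  qed
  define p where "p = (2 * \<kappa>) *\<^sub>R (a - y)"
  define b where "b = enn2real (\<psi> y) + 2 * \<kappa> * (norm (a - y))\<^sup>2"
  show ?thesis
  proof (rule that[of b p])
    show "c \<le> b"
    proof (cases "dist y a < r")
      case True
      then have "ennreal c < \<psi> y" using r by blast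
      then have "c \<le> enn2real (\<psi> y)"
        using y(1) c by (cases "\<psi> y") (auto simp: ennreal_less_iff)
      then show ?thesis using \<kappa> by (simp add: b_def add_increasing2)
    next
      case False
      then have "r\<^sup>2 \<le> (norm (a - y))\<^sup>2"
        using r by (intro power_mono) (auto simp: dist_norm norm_minus_commute)
      then have "\<kappa> * r\<^sup>2 \<le> \<kappa> * (norm (a - y))\<^sup>2" using \<kappa> by simp
      moreover have "\<kappa> * r\<^sup>2 = c + 1" using r by (simp add: \<kappa>_def)
      moreover have "enn2real (\<psi> y) \<ge> 0" by simp
      ultimately show ?thesis using c unfolding b_def by linarith
    qed
    show "ennreal (b + inner p (w - a)) \<le> \<psi> w" for w
    proof (cases "\<psi> w = \<infinity>")
      case False
      have "inner p (w - a) = 2 * \<kappa> * inner (a - y) (w - y) - 2 * \<kappa> * (norm (a - y))\<^sup>2"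
        by (simp add: p_def power2_norm_eq_inner inner_simps algebra_simps)
      moreover have "inner (a - y) (w - y) = - inner (y - a) (w - y)"
        by (simp add: inner_simps)
      ultimately have "b + inner p (w - a) \<le> enn2real (\<psi> w)"
        using sub[OF False] by (simp add: b_def)
      then show ?thesis
        using False by (metis ennreal_enn2real ennreal_leI infinity_ennreal_def less_top)
    qed simp
  qed
qed

section \<open>Averages over sets of finite measure and Jensen's inequality\<close>

text \<open>On null sets the junk value is \<open>0\<close>, which need not be close to the values of \<open>u\<close>.\<close>

definition avg :: "'w measure \<Rightarrow> ('w \<Rightarrow> 'h::{banach,second_countable_topology}) \<Rightarrow> 'w set \<Rightarrow> 'h" where
  "avg M u B = (\<integral>\<omega>. indicator B \<omega> *\<^sub>R u \<omega> \<partial>M) /\<^sub>R measure M B"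

text \<open>Integrate over \<open>B\<close> an affine minorant based at the average: its linear part
  integrates to 0, leaving \<open>b\<close> times the measure of \<open>B\<close>. Multiplying by
  the measure instead of dividing lets the inequality cover null sets, whatever
  \<open>\<psi>\<close> does at the junk value.\<close>

lemma Jensen_avg:
  fixes \<psi> :: "'h::{real_inner,banach,second_countable_topology} \<Rightarrow> ennreal"
  assumes \<psi>: "proper_fun \<psi>" "lsc_fun \<psi>" "convex_fun \<psi>"
    and B [measurable]: "B \<in> sets M" and fin: "emeasure M B < \<infinity>"
    and u: "integrable M (\<lambda>\<omega>. indicator B \<omega> *\<^sub>R u \<omega>)"
  shows "\<psi> (avg M u B) * emeasure M B \<le> (\<integral>\<^sup>+\<omega>. \<psi> (u \<omega>) * indicator B \<omega> \<partial>M)"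
proof (cases "measure M B = 0")
  case True
  then have "emeasure M B = 0"
    using fin by (auto simp: measure_def enn2real_eq_0_iff)
  then show ?thesis by simp
next
  case False
  define \<mu> where "\<mu> = measure M B"
  have \<mu>: "\<mu> > 0" "emeasure M B = ennreal \<mu>"
    using False fin by (auto simp: \<mu>_def less_le emeasure_eq_ennreal_measure)
  let ?a = "avg M u B"
  \<comment> \<open>The value at the average may be infinite, so the bound is proved for every real
    \<open>c\<close> below it and completed by a density argument.\<close>
  have *: "ennreal c * emeasure M B \<le> (\<integral>\<^sup>+\<omega>. \<psi> (u \<omega>) * indicator B \<omega> \<partial>M)" if c: "ennreal c < \<psi> ?a" "c \<ge> 0" for c
  proof -
    obtain b p where bp: "c \<le> b" "\<And>w. ennreal (b + inner p (w - ?a)) \<le> \<psi> w"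
      using affine_minorant[OF \<psi> c] by blast
    let ?f = "\<lambda>\<omega>. indicator B \<omega> * (b - inner p ?a) + inner p (indicator B \<omega> *\<^sub>R u \<omega>)"
    have i1: "integrable M (\<lambda>\<omega>. indicator B \<omega> * (b - inner p ?a))"
      using fin by (intro integrable_mult_left integrable_real_indicator) auto
    have i2: "integrable M (\<lambda>\<omega>. inner p (indicator B \<omega> *\<^sub>R u \<omega>))"
      using u by (intro integrable_inner_right) auto
    have "(\<integral>\<omega>. ?f \<omega> \<partial>M) = \<mu> * (b - inner p ?a) + inner p (\<integral>\<omega>. indicator B \<omega> *\<^sub>R u \<omega> \<partial>M)"
      using i1 i2 u fin by (subst Bochner_Integration.integral_add) (auto simp: \<mu>_def simp del: inner_scaleR_right)
    also have "(\<integral>\<omega>. indicator B \<omega> *\<^sub>R u \<omega> \<partial>M) = \<mu> *\<^sub>R ?a"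
      using \<mu> by (simp add: avg_def \<mu>_def)
    finally have I: "(\<integral>\<omega>. ?f \<omega> \<partial>M) = \<mu> * b" by (simp add: algebra_simps)
    have "ennreal c * emeasure M B \<le> ennreal (\<integral>\<omega>. ?f \<omega> \<partial>M)"
      unfolding I \<mu> using bp(1) c \<mu>(1) by (simp add: ennreal_mult[symmetric] mult.commute ennreal_leI)
    \<comment> \<open>The minorant may be negative. Its positive part still lies below
      \<open>\<psi>\<close> and turns the Bochner integral into a nonnegative one.\<close>
    also have "\<dots> \<le> ennreal (\<integral>\<omega>. max 0 (?f \<omega>) \<partial>M)"
      by (intro ennreal_leI integral_mono integrable_max Bochner_Integration.integrable_add i1 i2) auto
    also have "\<dots> = (\<integral>\<^sup>+\<omega>. ennreal (max 0 (?f \<omega>)) \<partial>M)"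
      by (intro nn_integral_eq_integral[symmetric] integrable_max Bochner_Integration.integrable_add i1 i2) auto
    also have "\<dots> \<le> (\<integral>\<^sup>+\<omega>. \<psi> (u \<omega>) * indicator B \<omega> \<partial>M)"
    proof (intro nn_integral_mono)
      fix \<omega>
      show "ennreal (max 0 (?f \<omega>)) \<le> \<psi> (u \<omega>) * indicator B \<omega>"
        using bp(2)[of "u \<omega>"] by (auto simp: indicator_def max_def inner_diff_right algebra_simps)
    qed
    finally show ?thesis .
  qed
  show ?thesis
  proof (rule ccontr)
    assume "\<not> ?thesis"
    then have "(\<integral>\<^sup>+\<omega>. \<psi> (u \<omega>) * indicator B \<omega> \<partial>M) / ennreal \<mu> < \<psi> ?a"
      using \<mu> by (simp add: not_le divide_less_ennreal)
    then obtain c where c: "(\<integral>\<^sup>+\<omega>. \<psi> (u \<omega>) * indicator B \<omega> \<partial>M) / ennreal \<mu> < c" "c < \<psi> ?a"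
      using dense by blast
    then have "c \<noteq> \<infinity>" by auto
    then obtain r where r: "c = ennreal r" "r \<ge> 0" by (cases c) auto
    have "(\<integral>\<^sup>+\<omega>. \<psi> (u \<omega>) * indicator B \<omega> \<partial>M) < c * ennreal \<mu>"
      using c(1) \<mu> by (simp add: divide_less_ennreal)
    then show False using *[of r] c r \<mu> by auto
  qed
qed

lemma nn_integral_countable_partition:
  fixes i :: "'w \<Rightarrow> nat"
  assumes [measurable]: "i \<in> M \<rightarrow>\<^sub>M count_space UNIV" "f \<in> borel_measurable M"
  shows "(\<integral>\<^sup>+\<omega>. f \<omega> \<partial>M) = (\<Sum>k. \<integral>\<^sup>+\<omega>. f \<omega> * indicator (i -` {k} \<inter> space M) \<omega> \<partial>M)"
proof -
  have "(\<integral>\<^sup>+\<omega>. f \<omega> \<partial>M) = (\<integral>\<^sup>+\<omega>. (\<Sum>k. f \<omega> * indicator (i -` {k} \<inter> space M) \<omega>) \<partial>M)"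
  proof (rule nn_integral_cong)
    fix \<omega> assume "\<omega> \<in> space M"
    then have "(\<Sum>k. f \<omega> * indicator (i -` {k} \<inter> space M) \<omega>) = (\<Sum>k\<in>{i \<omega>}. f \<omega> * indicator (i -` {k} \<inter> space M) \<omega>)"
      by (intro suminf_finite) (auto simp: indicator_def)
    then show "f \<omega> = (\<Sum>k. f \<omega> * indicator (i -` {k} \<inter> space M) \<omega>)"
      using \<open>\<omega> \<in> space M\<close> by simp
  qed
  also have "\<dots> = (\<Sum>k. \<integral>\<^sup>+\<omega>. f \<omega> * indicator (i -` {k} \<inter> space M) \<omega> \<partial>M)"
    by (intro nn_integral_suminf borel_measurable_times_ennreal borel_measurable_indicator
        measurable_sets[OF assms(1)] assms(2)) auto
  finally show ?thesis .
qed

text \<open>A countable partition is encoded by its index map \<open>i\<close>, with the fibres as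
  cells. The averaged function is then \<open>cell_avg M i u\<close> composed with \<open>i\<close>,
  which is measurable because \<open>i\<close> maps into a discrete space.\<close>

definition cell_avg :: "'w measure \<Rightarrow> ('w \<Rightarrow> nat) \<Rightarrow> ('w \<Rightarrow> 'h::{banach,second_countable_topology}) \<Rightarrow> nat \<Rightarrow> 'h" where
  "cell_avg M i u k = avg M u (i -` {k} \<inter> space M)"

lemma L2_integrable_on_finite:
  assumes u: "u \<in> L2 M" and [measurable]: "B \<in> sets M" and fin: "emeasure M B < \<infinity>"
  shows "integrable M (\<lambda>\<omega>. indicator B \<omega> *\<^sub>R u \<omega>)"
proof (rule Bochner_Integration.integrable_bound)
  have [measurable]: "u \<in> borel_measurable M" using u by (simp add: L2_def)
  show "integrable M (\<lambda>\<omega>. indicator B \<omega> + (norm (u \<omega>))\<^sup>2 :: real)"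
    using u fin by (auto simp: L2_def)
  show "(\<lambda>\<omega>. indicator B \<omega> *\<^sub>R u \<omega>) \<in> borel_measurable M" by measurable
  have "x \<le> 1 + x\<^sup>2" for x :: real
    using zero_le_power2[of "x - 1"] zero_le_power2[of x] unfolding power2_diff by (simp only: power_one mult_1_right)
  then show "AE \<omega> in M. norm (indicator B \<omega> *\<^sub>R u \<omega>) \<le> norm (indicator B \<omega> + (norm (u \<omega>))\<^sup>2)"
    by (auto simp: indicator_def)
qed

lemma lift_fun_cell_avg_le:
  fixes \<psi> :: "'h::{real_inner,banach,second_countable_topology} \<Rightarrow> ennreal"
  assumes \<psi>: "proper_fun \<psi>" "lsc_fun \<psi>" "convex_fun \<psi>"
    and i [measurable]: "i \<in> M \<rightarrow>\<^sub>M count_space UNIV"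
    and fin: "\<And>k. emeasure M (i -` {k} \<inter> space M) < \<infinity>"
    and u: "u \<in> L2 M"
  shows "lift_fun M \<psi> (\<lambda>\<omega>. cell_avg M i u (i \<omega>)) \<le> lift_fun M \<psi> u"
proof -
  note [measurable (raw)] = lsc_fun_measurable_compose[OF \<psi>(2)]
  have [measurable]: "u \<in> borel_measurable M" using u by (simp add: L2_def)
  have "lift_fun M \<psi> (\<lambda>\<omega>. cell_avg M i u (i \<omega>))
      = (\<Sum>k. \<integral>\<^sup>+\<omega>. \<psi> (cell_avg M i u (i \<omega>)) * indicator (i -` {k} \<inter> space M) \<omega> \<partial>M)"
    unfolding lift_fun_def by (rule nn_integral_countable_partition) measurable
  also have "\<dots> = (\<Sum>k. \<psi> (cell_avg M i u k) * emeasure M (i -` {k} \<inter> space M))"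
  proof (intro suminf_cong)
    fix k
    have "(\<integral>\<^sup>+\<omega>. \<psi> (cell_avg M i u (i \<omega>)) * indicator (i -` {k} \<inter> space M) \<omega> \<partial>M)
      = (\<integral>\<^sup>+\<omega>. \<psi> (cell_avg M i u k) * indicator (i -` {k} \<inter> space M) \<omega> \<partial>M)"
      by (intro nn_integral_cong) (auto simp: indicator_def)
    then show "(\<integral>\<^sup>+\<omega>. \<psi> (cell_avg M i u (i \<omega>)) * indicator (i -` {k} \<inter> space M) \<omega> \<partial>M)
      = \<psi> (cell_avg M i u k) * emeasure M (i -` {k} \<inter> space M)"
      by (simp add: nn_integral_cmult_indicator)
  qed
  also have "\<dots> \<le> (\<Sum>k. \<integral>\<^sup>+\<omega>. \<psi> (u \<omega>) * indicator (i -` {k} \<inter> space M) \<omega> \<partial>M)"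
    unfolding cell_avg_def
    by (intro suminf_le Jensen_avg \<psi> fin L2_integrable_on_finite u) measurable
  also have "\<dots> = lift_fun M \<psi> u"
    unfolding lift_fun_def by (rule nn_integral_countable_partition[symmetric]) measurable
  finally show ?thesis .
qed

text \<open>Closed balls are convex, so averaging cannot leave them. Positive measure rules out the
  junk value of \<open>avg\<close> on null sets.\<close>

lemma dist_avg_le:
  fixes u :: "'w \<Rightarrow> 'h::{banach,second_countable_topology}"
  assumes [measurable]: "B \<in> sets M" and fin: "emeasure M B < \<infinity>" and pos: "emeasure M B \<noteq> 0"
    and u: "integrable M (\<lambda>\<omega>. indicator B \<omega> *\<^sub>R u \<omega>)"
    and r: "\<And>\<omega>. \<omega> \<in> B \<Longrightarrow> dist (u \<omega>) c \<le> r"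
  shows "dist (avg M u B) c \<le> r"
proof -
  have \<mu>: "measure M B > 0"
    using fin pos by (auto simp: measure_def enn2real_positive_iff zero_less_iff_neq_zero)
  have ic: "integrable M (\<lambda>\<omega>. indicator B \<omega> *\<^sub>R c)" and ir: "integrable M (\<lambda>\<omega>. indicator B \<omega> * r)"
    using fin by (auto intro!: integrable_scaleR_left integrable_mult_left)
  have int: "integrable M (\<lambda>\<omega>. indicator B \<omega> *\<^sub>R u \<omega> - indicator B \<omega> *\<^sub>R c)"
    using u ic by (rule Bochner_Integration.integrable_diff)
  have "measure M B *\<^sub>R (avg M u B - c) = (\<integral>\<omega>. indicator B \<omega> *\<^sub>R u \<omega> - indicator B \<omega> *\<^sub>R c \<partial>M)"
    using u ic \<mu> fin by (simp add: avg_def scaleR_diff_right)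
  then have "norm (measure M B *\<^sub>R (avg M u B - c)) \<le> (\<integral>\<omega>. norm (indicator B \<omega> *\<^sub>R u \<omega> - indicator B \<omega> *\<^sub>R c) \<partial>M)"
    by simp
  also have "\<dots> \<le> (\<integral>\<omega>. indicator B \<omega> * r \<partial>M)"
    using r by (intro integral_mono integrable_norm int ir) (auto simp: indicator_def dist_norm)
  also have "\<dots> = measure M B * r"
    using fin by simp
  finally show ?thesis
    using \<mu> by (simp add: dist_norm)
qed

section \<open>Fine partitions and approximation by cell averages\<close>

text \<open>Each point receives the first scale \<open>1 / Suc l\<close> below \<open>g\<close> and
  the first member of a dense sequence within that scale of \<open>u\<close>; taking least indices
  keeps both choices measurable. The pair is coded as one number, so radius and centre depend on the
  cell alone.\<close>

lemma mesh_partition: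
  fixes u :: "'w \<Rightarrow> 'h::{metric_space,second_countable_topology}" and g :: "'w \<Rightarrow> real"
  assumes [measurable]: "u \<in> borel_measurable M" "g \<in> borel_measurable M"
    and g: "\<And>\<omega>. \<omega> \<in> space M \<Longrightarrow> g \<omega> > 0"
  obtains i :: "'w \<Rightarrow> nat" and r :: "nat \<Rightarrow> real" and c :: "nat \<Rightarrow> 'h"
  where "i \<in> M \<rightarrow>\<^sub>M count_space UNIV" "\<And>k. r k > 0"
    "\<And>\<omega>. \<omega> \<in> space M \<Longrightarrow> r (i \<omega>) < g \<omega>"
    "\<And>\<omega>. \<omega> \<in> space M \<Longrightarrow> dist (u \<omega>) (c (i \<omega>)) < r (i \<omega>)"
proof -
  obtain D :: "'h set" where D: "countable D" "\<And>X. open X \<Longrightarrow> X \<noteq> {} \<Longrightarrow> \<exists>d\<in>D. d \<in> X"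
    by (erule countable_dense_setE)
  define q where "q = from_nat_into D"
  have q: "\<exists>n. dist x (q n) < e" if e: "e > 0" for x e
  proof -
    obtain d where "d \<in> D" "d \<in> ball x e" using D(2)[of "ball x e"] e by auto
    moreover obtain n where "d = q n"
      using from_nat_into_surj[OF D(1) \<open>d \<in> D\<close>] by (auto simp: q_def)
    ultimately show ?thesis by auto
  qed
  define l where "l \<omega> = (LEAST l. 1 / real (Suc l) < g \<omega>)" for \<omega>
  define k where "k \<omega> = (LEAST k. dist (u \<omega>) (q k) < 1 / real (Suc (l \<omega>)))" for \<omega>
  have l [measurable]: "l \<in> M \<rightarrow>\<^sub>M count_space UNIV"
    unfolding l_def by measurable
  have k [measurable]: "k \<in> M \<rightarrow>\<^sub>M count_space UNIV"
    unfolding k_def by measurable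
  have l_g: "1 / real (Suc (l \<omega>)) < g \<omega>" if "\<omega> \<in> space M" for \<omega>
    unfolding l_def by (rule LeastI_ex) (use reals_Archimedean[OF g[OF that]] in \<open>simp add: inverse_eq_divide\<close>)
  have k_l: "dist (u \<omega>) (q (k \<omega>)) < 1 / real (Suc (l \<omega>))" for \<omega>
    unfolding k_def by (rule LeastI_ex) (rule q, simp)
  show ?thesis
  proof (rule that[of "\<lambda>\<omega>. prod_encode (l \<omega>, k \<omega>)" "\<lambda>n. 1 / real (Suc (fst (prod_decode n)))" "\<lambda>n. q (snd (prod_decode n))"])
    show "(\<lambda>\<omega>. prod_encode (l \<omega>, k \<omega>)) \<in> M \<rightarrow>\<^sub>M count_space UNIV" by measurable
  qed (use l_g k_l in auto)
qed

text \<open>The mesh \<open>g\<close> is a square integrable function rather than a constant: this keeps the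
  approximation in \<open>L2\<close> and gives every cell finite measure, since \<open>g\<close> is bounded below on it.\<close>

lemma fine_cell_avg:
  fixes u :: "'w \<Rightarrow> 'h::{real_inner,banach,second_countable_topology}" and g :: "'w \<Rightarrow> real"
  assumes u: "u \<in> L2 M" and g [measurable]: "g \<in> borel_measurable M"
    and g_pos: "\<And>\<omega>. \<omega> \<in> space M \<Longrightarrow> g \<omega> > 0"
    and g_fin: "(\<integral>\<^sup>+\<omega>. ennreal ((g \<omega>)\<^sup>2) \<partial>M) < \<infinity>"
  obtains i :: "'w \<Rightarrow> nat"
  where "i \<in> M \<rightarrow>\<^sub>M count_space UNIV" "\<And>k. emeasure M (i -` {k} \<inter> space M) < \<infinity>"
    "AE \<omega> in M. dist (cell_avg M i u (i \<omega>)) (u \<omega>) \<le> 2 * g \<omega>"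
proof -
  have [measurable]: "u \<in> borel_measurable M" using u by (simp add: L2_def)
  obtain i :: "'w \<Rightarrow> nat" and r :: "nat \<Rightarrow> real" and c :: "nat \<Rightarrow> 'h"
    where i [measurable]: "i \<in> M \<rightarrow>\<^sub>M count_space UNIV" and r: "\<And>k. r k > 0"
      and rg: "\<And>\<omega>. \<omega> \<in> space M \<Longrightarrow> r (i \<omega>) < g \<omega>"
      and uc: "\<And>\<omega>. \<omega> \<in> space M \<Longrightarrow> dist (u \<omega>) (c (i \<omega>)) < r (i \<omega>)"
    by (rule mesh_partition[OF \<open>u \<in> borel_measurable M\<close> g g_pos]) (auto intro: that)
  have fin: "emeasure M (i -` {k} \<inter> space M) < \<infinity>" for k
  proof -
    \<comment> \<open>Chebyshev's inequality: \<open>g\<close> exceeds \<open>r k\<close> on cell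
      \<open>k\<close>, and \<open>g\<close> is square integrable.\<close>
    have "ennreal ((r k)\<^sup>2) * emeasure M (i -` {k} \<inter> space M)
        = (\<integral>\<^sup>+\<omega>. ennreal ((r k)\<^sup>2) * indicator (i -` {k} \<inter> space M) \<omega> \<partial>M)"
      by (simp add: nn_integral_cmult_indicator)
    also have "\<dots> \<le> (\<integral>\<^sup>+\<omega>. ennreal ((g \<omega>)\<^sup>2) \<partial>M)"
    proof (rule nn_integral_mono)
      fix \<omega> assume \<omega>: "\<omega> \<in> space M"
      show "ennreal ((r k)\<^sup>2) * indicator (i -` {k} \<inter> space M) \<omega> \<le> ennreal ((g \<omega>)\<^sup>2)"
        using rg[OF \<omega>] r[of k] by (auto simp: indicator_def intro!: ennreal_leI power_mono)
    qed
    finally have "ennreal ((r k)\<^sup>2) * emeasure M (i -` {k} \<inter> space M) < \<infinity>"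
      using g_fin by (rule le_less_trans)
    then show ?thesis
      using r[of k] by (auto simp: ennreal_mult_less_top)
  qed
  \<comment> \<open>Averages over null cells are junk, but the null cells are countably many and
    together form a null set.\<close>
  have "AE \<omega> in M. \<forall>k. i \<omega> = k \<longrightarrow> emeasure M (i -` {k} \<inter> space M) \<noteq> 0"
    unfolding AE_all_countable
  proof
    fix k
    show "AE \<omega> in M. i \<omega> = k \<longrightarrow> emeasure M (i -` {k} \<inter> space M) \<noteq> 0"
    proof (cases "emeasure M (i -` {k} \<inter> space M) = 0")
      case True
      then have "i -` {k} \<inter> space M \<in> null_sets M" by auto
      then have "AE \<omega> in M. \<omega> \<notin> i -` {k} \<inter> space M" by (rule AE_not_in)
      then show ?thesis using AE_space by eventually_elim auto
    qed simp
  qed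
  then have "AE \<omega> in M. dist (cell_avg M i u (i \<omega>)) (u \<omega>) \<le> 2 * g \<omega>"
    using AE_space
  proof eventually_elim
    case (elim \<omega>)
    have "dist (cell_avg M i u (i \<omega>)) (c (i \<omega>)) \<le> r (i \<omega>)"
      unfolding cell_avg_def
    proof (intro dist_avg_le fin L2_integrable_on_finite u)
      show "dist (u \<omega>') (c (i \<omega>)) \<le> r (i \<omega>)" if "\<omega>' \<in> i -` {i \<omega>} \<inter> space M" for \<omega>'
        using uc[of \<omega>'] that by auto
    qed (use elim in auto)
    \<comment> \<open>Both the average and the value of \<open>u\<close> lie within
      \<open>r (i \<omega>)\<close> of the same centre, hence the factor 2.\<close>
    then show ?case
      using uc[of \<omega>] rg[of \<omega>] elim dist_triangle2[of "cell_avg M i u (i \<omega>)" "u \<omega>" "c (i \<omega>)"] by simp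
  qed
  with i fin show ?thesis by (rule that)
qed

text \<open>Sigma-finiteness supplies a positive, finite, integrable function, and its square root
  has the required properties. Positive multiples of it serve as meshes in
  \<open>fine_cell_avg\<close>.\<close>

lemma (in sigma_finite_measure) positive_square_integrable_exists:
  obtains h :: "'a \<Rightarrow> real" where "h \<in> borel_measurable M" "\<And>\<omega>. \<omega> \<in> space M \<Longrightarrow> h \<omega> > 0"
    "(\<integral>\<^sup>+\<omega>. ennreal ((h \<omega>)\<^sup>2) \<partial>M) < \<infinity>"
proof -
  obtain f where f [measurable]: "f \<in> borel_measurable M" and fin: "integral\<^sup>N M f \<noteq> \<infinity>"
    and pos: "\<And>x. x \<in> space M \<Longrightarrow> 0 < f x \<and> f x < \<infinity>"
    using Ex_finite_integrable_function by blast
  show ?thesis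
  proof (rule that[of "\<lambda>x. sqrt (enn2real (f x))"])
    show "sqrt (enn2real (f \<omega>)) > 0" if "\<omega> \<in> space M" for \<omega>
      using pos[OF that] by (simp add: enn2real_positive_iff)
    have "(\<integral>\<^sup>+\<omega>. ennreal ((sqrt (enn2real (f \<omega>)))\<^sup>2) \<partial>M) = integral\<^sup>N M f"
      using pos by (intro nn_integral_cong) simp
    then show "(\<integral>\<^sup>+\<omega>. ennreal ((sqrt (enn2real (f \<omega>)))\<^sup>2) \<partial>M) < \<infinity>"
      using fin by (simp add: less_top)
  qed measurable
qed

section \<open>The liminf inequality\<close>

text \<open>Testing a cell average against \<open>x\<close> amounts, up to division by the measure,
  to testing the function against the \<open>L2\<close> function equal to \<open>x\<close> on the
  cell and 0 elsewhere. On a null cell both sides of this identity are 0, since division by zero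
  gives 0.\<close>

lemma weak_conv_cell_avg:
  fixes u :: "'w \<Rightarrow> 'h::{real_inner,banach,second_countable_topology}"
  assumes [measurable]: "i \<in> M \<rightarrow>\<^sub>M count_space UNIV"
    and fin: "emeasure M (i -` {k} \<inter> space M) < \<infinity>"
    and us: "\<And>n. us n \<in> L2 M" and u: "u \<in> L2 M" and conv: "weak_conv (L2 M) (L2_inner M) us u"
  shows "weak_conv UNIV inner (\<lambda>n. cell_avg M i (us n) k) (cell_avg M i u k)"
  unfolding weak_conv_def
proof
  fix x :: 'h
  let ?B = "i -` {k} \<inter> space M"
  let ?t = "\<lambda>\<omega>. indicator ?B \<omega> *\<^sub>R x"
  have "(\<lambda>\<omega>. (norm (?t \<omega>))\<^sup>2) = (\<lambda>\<omega>. indicator ?B \<omega> * (norm x)\<^sup>2)"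
    by (auto simp: indicator_def)
  then have t: "?t \<in> L2 M"
    using fin measurable_sets[OF assms(1), of "{k}"]
    by (auto simp: L2_def intro!: borel_measurable_scaleR borel_measurable_indicator)
  have eq: "inner (cell_avg M i w k) x = L2_inner M w ?t / measure M ?B" if w: "w \<in> L2 M" for w
  proof -
    have "L2_inner M w ?t = (\<integral>\<omega>. inner (indicator ?B \<omega> *\<^sub>R w \<omega>) x \<partial>M)"
      unfolding L2_inner_def by (intro Bochner_Integration.integral_cong) (auto simp: indicator_def)
    also have "\<dots> = inner (\<integral>\<omega>. indicator ?B \<omega> *\<^sub>R w \<omega> \<partial>M) x"
      using L2_integrable_on_finite[OF w _ fin] by (intro integral_inner_left) auto
    finally show ?thesis
      by (simp add: cell_avg_def avg_def divide_inverse mult.commute)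
  qed
  have "(\<lambda>n. L2_inner M (us n) ?t) \<longlonglongrightarrow> L2_inner M u ?t"
    using conv t by (simp add: weak_conv_def)
  then show "(\<lambda>n. inner (cell_avg M i (us n) k) x) \<longlonglongrightarrow> inner (cell_avg M i u k) x"
    unfolding eq[OF us] eq[OF u] divide_inverse by (rule tendsto_mult_right)
qed

lemma lift_fun_liminf:
  fixes \<phi>s :: "nat \<Rightarrow> 'h::{real_inner,banach,second_countable_topology} \<Rightarrow> ennreal"
  assumes "sigma_finite_measure M"
    and \<phi>s: "\<And>n. proper_fun (\<phi>s n)" "\<And>n. lsc_fun (\<phi>s n)" "\<And>n. convex_fun (\<phi>s n)" and \<phi>: "lsc_fun \<phi>"
    and liminf: "\<And>xs x. weak_conv UNIV inner xs x \<Longrightarrow> \<phi> x \<le> liminf (\<lambda>n. \<phi>s n (xs n))"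
    and us: "\<And>n. us n \<in> L2 M" and u: "u \<in> L2 M" and conv: "weak_conv (L2 M) (L2_inner M) us u"
  shows "lift_fun M \<phi> u \<le> liminf (\<lambda>n. lift_fun M (\<phi>s n) (us n))"
proof -
  interpret sigma_finite_measure M by fact
  have [measurable]: "u \<in> borel_measurable M" using u by (simp add: L2_def)
  obtain h where h [measurable]: "h \<in> borel_measurable M" and h_pos: "\<And>\<omega>. \<omega> \<in> space M \<Longrightarrow> h \<omega> > 0"
    and h_fin: "(\<integral>\<^sup>+\<omega>. ennreal ((h \<omega>)\<^sup>2) \<partial>M) < \<infinity>"
    by (rule positive_square_integrable_exists) (auto intro: that)
  define L where "L = liminf (\<lambda>n. lift_fun M (\<phi>s n) (us n))"
  \<comment> \<open>For each \<open>j\<close> a single partition, chosen from \<open>u\<close>,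
    serves all \<open>us n\<close>, so that \<open>n\<close> can tend to infinity cell by
    cell.\<close>
  have "\<exists>U. U \<in> borel_measurable M \<and> (AE \<omega> in M. dist (U \<omega>) (u \<omega>) \<le> 2 * (h \<omega> / Suc j)) \<and> lift_fun M \<phi> U \<le> L" for j
  proof -
    have "(\<integral>\<^sup>+\<omega>. ennreal ((h \<omega> / Suc j)\<^sup>2) \<partial>M) \<le> (\<integral>\<^sup>+\<omega>. ennreal ((h \<omega>)\<^sup>2) \<partial>M)"
      using h_pos by (intro nn_integral_mono ennreal_leI power_mono)
        (auto simp: divide_le_eq less_imp_le mult_le_cancel_left1 algebra_simps intro!: divide_nonneg_pos)
    then have g_fin: "(\<integral>\<^sup>+\<omega>. ennreal ((h \<omega> / Suc j)\<^sup>2) \<partial>M) < \<infinity>"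
      using h_fin by (rule le_less_trans)
    obtain i :: "_ \<Rightarrow> nat"
      where i [measurable]: "i \<in> M \<rightarrow>\<^sub>M count_space UNIV"
        and fin: "\<And>k. emeasure M (i -` {k} \<inter> space M) < \<infinity>"
        and close: "AE \<omega> in M. dist (cell_avg M i u (i \<omega>)) (u \<omega>) \<le> 2 * (h \<omega> / Suc j)"
      by (rule fine_cell_avg[OF u _ _ g_fin]) (use h_pos in \<open>auto intro: that\<close>)
    \<comment> \<open>The hypothesis in \<open>H\<close> is applied at each point to the averages
      over its cell; Fatou's lemma and Jensen's inequality for \<open>us n\<close> follow.\<close>
    have "lift_fun M \<phi> (\<lambda>\<omega>. cell_avg M i u (i \<omega>))
        \<le> (\<integral>\<^sup>+\<omega>. liminf (\<lambda>n. \<phi>s n (cell_avg M i (us n) (i \<omega>))) \<partial>M)"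
      unfolding lift_fun_def
      by (intro nn_integral_mono liminf weak_conv_cell_avg i fin us u conv)
    also have "\<dots> \<le> liminf (\<lambda>n. \<integral>\<^sup>+\<omega>. \<phi>s n (cell_avg M i (us n) (i \<omega>)) \<partial>M)"
      by (intro nn_integral_liminf lsc_fun_measurable_compose[OF \<phi>s(2)]) measurable
    also have "\<dots> \<le> L"
      unfolding L_def
      using lift_fun_cell_avg_le[OF \<phi>s i fin us]
      by (intro Liminf_mono always_eventually allI) (simp add: lift_fun_def)
    finally have "lift_fun M \<phi> (\<lambda>\<omega>. cell_avg M i u (i \<omega>)) \<le> L" .
    with close show ?thesis
      by (intro exI[of _ "\<lambda>\<omega>. cell_avg M i u (i \<omega>)"] conjI) measurable
  qed
  \<comment> \<open>The bound \<open>L\<close> does not depend on \<open>j\<close> and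
    \<open>U j\<close> tends to \<open>u\<close> almost everywhere, so lower semicontinuity and a
    second use of Fatou's lemma transfer the bound to \<open>u\<close>.\<close>
  then obtain U where U: "\<And>j. U j \<in> borel_measurable M" "\<And>j. lift_fun M \<phi> (U j) \<le> L"
    and close: "\<And>j. AE \<omega> in M. dist (U j \<omega>) (u \<omega>) \<le> 2 * (h \<omega> / Suc j)"
    by metis
  have "AE \<omega> in M. \<forall>j. dist (U j \<omega>) (u \<omega>) \<le> 2 * (h \<omega> / Suc j)"
    using close by (simp add: AE_all_countable)
  then have "AE \<omega> in M. \<phi> (u \<omega>) \<le> liminf (\<lambda>j. \<phi> (U j \<omega>))"
  proof eventually_elim
    case (elim \<omega>)
    have "(\<lambda>j. 2 * (h \<omega> * (1 / Suc j))) \<longlonglongrightarrow> 2 * (h \<omega> * 0)"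
      by (intro tendsto_mult tendsto_const LIMSEQ_Suc[OF lim_1_over_n])
    then have "(\<lambda>j. 2 * (h \<omega> / Suc j)) \<longlonglongrightarrow> 0" by simp
    then have "(\<lambda>j. dist (U j \<omega>) (u \<omega>)) \<longlonglongrightarrow> 0"
      by (rule tendsto_sandwich[OF _ _ tendsto_const, rotated 2]) (use elim in simp_all)
    then have "(\<lambda>j. U j \<omega>) \<longlonglongrightarrow> u \<omega>"
      by (rule tendsto_dist_iff[THEN iffD2])
    then show ?case by (rule lsc_fun_Liminf[OF \<phi>])
  qed
  then have "lift_fun M \<phi> u \<le> (\<integral>\<^sup>+\<omega>. liminf (\<lambda>j. \<phi> (U j \<omega>)) \<partial>M)"
    unfolding lift_fun_def by (rule nn_integral_mono_AE)
  also have "\<dots> \<le> liminf (\<lambda>j. lift_fun M \<phi> (U j))"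
    unfolding lift_fun_def by (intro nn_integral_liminf lsc_fun_measurable_compose[OF \<phi> U(1)])
  also have "\<dots> \<le> L"
    using Liminf_mono[of "\<lambda>j. lift_fun M \<phi> (U j)" "\<lambda>_. L" sequentially] U(2) by (simp add: Liminf_const)
  finally show ?thesis by (simp add: L_def)
qed

section \<open>Values at the origin on spaces of infinite measure\<close>

text \<open>If \<open>\<psi> 0\<close> were positive, \<open>\<psi>\<close> would exceed some
  \<open>c > 0\<close> on a ball of radius \<open>r\<close> about 0. Then
  \<open>\<psi>(u) / c + |u|^2 / r^2\<close> would be at least 1 everywhere, and its finite integral
  would bound the total measure.\<close>

lemma lsc_fun_zero_if_infinite_measure:
  fixes \<psi> :: "'h::{real_inner,banach,second_countable_topology} \<Rightarrow> ennreal"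
  assumes lsc: "lsc_fun \<psi>" and u: "u \<in> L2 M" and fin: "lift_fun M \<psi> u \<noteq> \<infinity>" and inf: "\<not> finite_measure M"
  shows "\<psi> 0 = 0"
proof (rule ccontr)
  assume "\<psi> 0 \<noteq> 0"
  then have "0 < \<psi> 0" by (simp add: zero_less_iff_neq_zero)
  then obtain c where c: "0 < c" "c < \<psi> 0" using dense by blast
  then have "c \<noteq> top" by auto
  have [measurable]: "u \<in> borel_measurable M" and u2: "integrable M (\<lambda>\<omega>. (norm (u \<omega>))\<^sup>2)"
    using u by (auto simp: L2_def)
  have [measurable]: "(\<lambda>\<omega>. \<psi> (u \<omega>)) \<in> borel_measurable M"
    by (rule lsc_fun_measurable_compose[OF lsc]) measurable
  obtain r where r: "r > 0" "\<And>x. dist x 0 < r \<Longrightarrow> c < \<psi> x"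
    using lsc_fun_ball[OF lsc c(2)] by blast
  have "emeasure M (space M) = (\<integral>\<^sup>+\<omega>. 1 \<partial>M)" by simp
  also have "\<dots> \<le> (\<integral>\<^sup>+\<omega>. \<psi> (u \<omega>) / c + ennreal ((norm (u \<omega>))\<^sup>2 / r\<^sup>2) \<partial>M)"
  proof (rule nn_integral_mono)
    fix \<omega>
    show "1 \<le> \<psi> (u \<omega>) / c + ennreal ((norm (u \<omega>))\<^sup>2 / r\<^sup>2)"
    proof (cases "norm (u \<omega>) < r")
      case True
      then have "c \<le> \<psi> (u \<omega>)" using r(2)[of "u \<omega>"] by (simp add: less_imp_le)
      then have "c / c \<le> \<psi> (u \<omega>) / c" by (rule divide_right_mono_ennreal)
      moreover have "c / c = 1" using c(1) \<open>c \<noteq> top\<close> by (cases c) (auto simp: divide_ennreal)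
      ultimately show ?thesis by (simp add: add_increasing2)
    next
      case False
      then have "1 \<le> (norm (u \<omega>))\<^sup>2 / r\<^sup>2"
        using r(1) by (simp add: power_mono)
      then have "1 \<le> ennreal ((norm (u \<omega>))\<^sup>2 / r\<^sup>2)" by simp
      then show ?thesis by (simp add: add_increasing)
    qed
  qed
  also have "\<dots> = (\<integral>\<^sup>+\<omega>. \<psi> (u \<omega>) \<partial>M) / c + (\<integral>\<^sup>+\<omega>. ennreal ((norm (u \<omega>))\<^sup>2 / r\<^sup>2) \<partial>M)"
    by (subst nn_integral_add) (auto simp: nn_integral_divide)
  also have "\<dots> < \<infinity>"
  proof -
    have "integrable M (\<lambda>\<omega>. (norm (u \<omega>))\<^sup>2 / r\<^sup>2)" using u2 by simp
    then have "(\<integral>\<^sup>+\<omega>. ennreal ((norm (u \<omega>))\<^sup>2 / r\<^sup>2) \<partial>M) < \<infinity>"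
      by (subst nn_integral_eq_integral) auto
    moreover have "(\<integral>\<^sup>+\<omega>. \<psi> (u \<omega>) \<partial>M) / c < \<infinity>"
      using fin c(1) by (auto simp: lift_fun_def less_top[symmetric] ennreal_divide_eq_top_iff)
    ultimately show ?thesis by simp
  qed
  finally show False
    using inf by (auto intro!: finite_measureI)
qed

section \<open>Construction of recovery sequences\<close>

text \<open>Take for \<open>\<kappa> n\<close> the largest \<open>k \<le> n\<close> such that
  \<open>P k\<close> holds at all indices from \<open>n\<close> on. The bound
  \<open>k \<le> n\<close> keeps the candidates finite, and each \<open>k\<close> is eventually a
  candidate, which forces \<open>\<kappa>\<close> to infinity.\<close>

lemma diagonal_sequence:
  fixes P :: "nat \<Rightarrow> nat \<Rightarrow> bool"
  assumes P: "\<And>k. eventually (P k) sequentially"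
  obtains \<kappa> :: "nat \<Rightarrow> nat" where "filterlim \<kappa> at_top sequentially" "eventually (\<lambda>n. P (\<kappa> n) n) sequentially"
proof -
  define S where "S n = {k. k \<le> n \<and> (\<forall>m\<ge>n. P k m)}" for n
  have S: "finite (S n)" for n by (rule finite_subset[of _ "{..n}"]) (auto simp: S_def)
  have ev: "eventually (\<lambda>n. k \<in> S n) sequentially" for k
  proof -
    obtain N where "\<forall>n\<ge>N. P k n" using P[of k] by (auto simp: eventually_sequentially)
    then show ?thesis
      unfolding eventually_sequentially S_def by (intro exI[of _ "max N k"]) auto
  qed
  show ?thesis
  proof (rule that[of "\<lambda>n. Max (S n)"])
    show "filterlim (\<lambda>n. Max (S n)) at_top sequentially"
      unfolding filterlim_at_top
    proof
      fix k show "eventually (\<lambda>n. k \<le> Max (S n)) sequentially"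
        using ev[of k] by eventually_elim (rule Max_ge[OF S])
    qed
    show "eventually (\<lambda>n. P (Max (S n)) n) sequentially"
      using ev[of 0]
    proof eventually_elim
      case (elim n)
      then have "Max (S n) \<in> S n" using S by (intro Max_in) auto
      then show ?case by (simp add: S_def)
    qed
  qed
qed

lemma norm_diff_power2_le:
  fixes x y z :: "'a::real_normed_vector"
  shows "(norm (x - z))\<^sup>2 \<le> 2 * (norm (x - y))\<^sup>2 + 2 * (norm (y - z))\<^sup>2"
proof -
  have "(norm (x - z))\<^sup>2 \<le> (norm (x - y) + norm (y - z))\<^sup>2"
    using norm_triangle_ineq[of "x - y" "y - z"] by (intro power_mono) auto
  also have "\<dots> \<le> 2 * (norm (x - y))\<^sup>2 + 2 * (norm (y - z))\<^sup>2"
    using sum_squares_bound[of "norm (x - y)" "norm (y - z)"] by (simp add: power2_sum)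
  finally show ?thesis .
qed

lemma L2_if_close:
  fixes v :: "'w \<Rightarrow> 'h::{real_inner,banach,second_countable_topology}"
  assumes v: "v \<in> L2 M" and w [measurable]: "w \<in> borel_measurable M"
    and d: "(\<integral>\<^sup>+\<omega>. ennreal ((norm (w \<omega> - v \<omega>))\<^sup>2) \<partial>M) \<le> ennreal d" "d \<ge> 0"
  shows "w \<in> L2 M" "L2_inner M (w - v) (w - v) \<le> d"
proof -
  have [measurable]: "v \<in> borel_measurable M" and v2: "integrable M (\<lambda>\<omega>. (norm (v \<omega>))\<^sup>2)"
    using v by (auto simp: L2_def)
  have int: "integrable M (\<lambda>\<omega>. (norm (w \<omega> - v \<omega>))\<^sup>2)"
    using d(1) by (intro integrableI_bounded) (auto intro: le_less_trans)
  have "integrable M (\<lambda>\<omega>. (norm (w \<omega>))\<^sup>2)"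
  proof (rule Bochner_Integration.integrable_bound)
    show "integrable M (\<lambda>\<omega>. 2 * (norm (w \<omega> - v \<omega>))\<^sup>2 + 2 * (norm (v \<omega>))\<^sup>2)"
      using int v2 by auto
    show "AE \<omega> in M. norm ((norm (w \<omega>))\<^sup>2) \<le> norm (2 * (norm (w \<omega> - v \<omega>))\<^sup>2 + 2 * (norm (v \<omega>))\<^sup>2)"
      using norm_diff_power2_le[of "w _" 0 "v _"] by auto
  qed measurable
  then show "w \<in> L2 M" by (simp add: L2_def)
  have "L2_inner M (w - v) (w - v) = (\<integral>\<omega>. (norm (w \<omega> - v \<omega>))\<^sup>2 \<partial>M)"
    by (simp add: L2_inner_def power2_norm_eq_inner)
  also have "\<dots> \<le> d"
    using d nn_integral_eq_integral[OF int] by simp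
  finally show "L2_inner M (w - v) (w - v) \<le> d" .
qed

text \<open>Partition and cutoff are fixed before \<open>n\<close>, so only finitely many points of
  \<open>H\<close> have to be recovered and one threshold for \<open>n\<close> works for all.
  Assumption \<open>M\<close> makes the constant continuation affordable: either constants have
  finite cost, or the continuation is 0 and is recovered without error.\<close>

lemma lift_fun_eventually_approx:
  fixes \<phi>s :: "nat \<Rightarrow> 'h::{real_inner,banach,second_countable_topology} \<Rightarrow> ennreal"
  assumes "sigma_finite_measure M"
    and \<phi>: "proper_fun \<phi>" "lsc_fun \<phi>" "convex_fun \<phi>"
    and r: "\<And>x. (\<lambda>n. r x n) \<longlonglongrightarrow> x" "\<And>x. limsup (\<lambda>n. \<phi>s n (r x n)) \<le> \<phi> x"
    and z: "\<phi> z \<noteq> \<infinity>"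
    and M: "finite_measure M \<or> z = 0 \<and> \<phi> 0 = 0 \<and> (\<forall>n. \<phi>s n 0 = 0 \<and> r 0 n = 0)"
    and v: "v \<in> L2 M" and v_fin: "lift_fun M \<phi> v \<noteq> \<infinity>" and \<delta>: "\<delta> > 0"
  shows "eventually (\<lambda>n. \<exists>w\<in>L2 M. L2_inner M (w - v) (w - v) \<le> \<delta> \<and>
    lift_fun M (\<phi>s n) w \<le> lift_fun M \<phi> v + ennreal \<delta>) sequentially"
proof -
  interpret sigma_finite_measure M by fact
  have v_meas [measurable]: "v \<in> borel_measurable M" and v2: "integrable M (\<lambda>\<omega>. (norm (v \<omega>))\<^sup>2)"
    using v by (auto simp: L2_def)
  have meas_\<phi>: "(\<lambda>\<omega>. \<phi> (f \<omega>)) \<in> borel_measurable M" if "f \<in> borel_measurable M" for f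
    by (rule lsc_fun_measurable_compose[OF \<phi>(2) that])
  \<comment> \<open>Error budget: the squared distance will cost \<open>2 * d + 2 * (2 * d)\<close>,
    the functional \<open>d + d\<close>; both are below \<open>8 * d\<close>.\<close>
  define d where "d = \<delta> / 8"
  have d: "d > 0" using \<delta> by (simp add: d_def)

  obtain h where h [measurable]: "h \<in> borel_measurable M" and h_pos: "\<And>\<omega>. \<omega> \<in> space M \<Longrightarrow> h \<omega> > 0"
    and h_fin: "(\<integral>\<^sup>+\<omega>. ennreal ((h \<omega>)\<^sup>2) \<partial>M) < \<infinity>"
    by (rule positive_square_integrable_exists) (auto intro: that)
  obtain I where I: "(\<integral>\<^sup>+\<omega>. ennreal ((h \<omega>)\<^sup>2) \<partial>M) = ennreal I" "I \<ge> 0"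
    using h_fin by (cases "\<integral>\<^sup>+\<omega>. ennreal ((h \<omega>)\<^sup>2) \<partial>M") auto
  \<comment> \<open>Scales the mesh so that its squared error costs at most \<open>d\<close>:
    \<open>4 * c^2 * I = d * I / (I + 1)\<close>.\<close>
  define c where "c = sqrt (d / (4 * (I + 1)))"
  have c: "c > 0" "4 * c\<^sup>2 * I \<le> d"
    using d I by (auto simp: c_def field_simps)
  have g_int: "(\<integral>\<^sup>+\<omega>. ennreal (a * (c * h \<omega>)\<^sup>2) \<partial>M) = ennreal (a * c\<^sup>2 * I)" if "a \<ge> 0" for a
  proof -
    have "(\<integral>\<^sup>+\<omega>. ennreal (a * (c * h \<omega>)\<^sup>2) \<partial>M) = (\<integral>\<^sup>+\<omega>. ennreal (a * c\<^sup>2) * ennreal ((h \<omega>)\<^sup>2) \<partial>M)"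
      using that by (intro nn_integral_cong) (simp add: ennreal_mult[symmetric] power_mult_distrib mult.assoc)
    also have "\<dots> = ennreal (a * c\<^sup>2) * ennreal I"
      by (simp add: nn_integral_cmult I)
    finally show ?thesis using that I by (simp add: ennreal_mult)
  qed
  obtain i :: "_ \<Rightarrow> nat"
    where i [measurable]: "i \<in> M \<rightarrow>\<^sub>M count_space UNIV"
      and fin: "\<And>k. emeasure M (i -` {k} \<inter> space M) < \<infinity>"
      and close: "AE \<omega> in M. dist (cell_avg M i v (i \<omega>)) (v \<omega>) \<le> 2 * (c * h \<omega>)"
    by (rule fine_cell_avg[of v M "\<lambda>\<omega>. c * h \<omega>"]) (use v h_pos c g_int[of 1] in \<open>auto intro: that\<close>)
  define a where "a = cell_avg M i v"
  have U_le: "lift_fun M \<phi> (\<lambda>\<omega>. a (i \<omega>)) \<le> lift_fun M \<phi> v"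
    unfolding a_def by (rule lift_fun_cell_avg_le[OF \<phi> i fin v])
  then have "(\<integral>\<^sup>+\<omega>. \<phi> (a (i \<omega>)) \<partial>M) \<noteq> \<infinity>"
    using v_fin by (auto simp: lift_fun_def top_unique)
  then have U_fin: "AE \<omega> in M. \<phi> (a (i \<omega>)) \<noteq> \<infinity>"
    by (intro nn_integral_noteq_infinite meas_\<phi>) measurable

  \<comment> \<open>\<open>Q\<close> dominates both the squared distance and the functional incurred
    where \<open>v\<close> is replaced by \<open>z\<close>. It is integrable, so cutting off at a
    large index \<open>m\<close> costs at most \<open>d\<close>.\<close>
  define Q where "Q \<omega> = ennreal ((norm (z - v \<omega>))\<^sup>2) + \<phi> z" for \<omega>
  have [measurable]: "Q \<in> borel_measurable M" unfolding Q_def by measurable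
  have Q_fin: "(\<integral>\<^sup>+\<omega>. Q \<omega> \<partial>M) < \<infinity>"
  proof -
    have "(\<integral>\<^sup>+\<omega>. Q \<omega> \<partial>M) = (\<integral>\<^sup>+\<omega>. ennreal ((norm (z - v \<omega>))\<^sup>2) \<partial>M) + \<phi> z * emeasure M (space M)"
      unfolding Q_def by (subst nn_integral_add) auto
    also have "\<dots> < \<infinity>"
    proof -
      have iz: "integrable M (\<lambda>\<omega>. 2 * (norm z)\<^sup>2 + 2 * (norm (v \<omega>))\<^sup>2)"
      proof (cases "finite_measure M")
        case True
        then show ?thesis using v2 by (auto intro!: finite_measure.integrable_const)
      next
        case False
        then show ?thesis using M v2 by auto
      qed
      have "(\<integral>\<^sup>+\<omega>. ennreal ((norm (z - v \<omega>))\<^sup>2) \<partial>M) \<le> (\<integral>\<^sup>+\<omega>. ennreal (2 * (norm z)\<^sup>2 + 2 * (norm (v \<omega>))\<^sup>2) \<partial>M)"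
        using norm_diff_power2_le[of z "v _" 0] by (intro nn_integral_mono ennreal_leI) simp
      also have "\<dots> < \<infinity>"
        using iz by (subst nn_integral_eq_integral) auto
      finally have "(\<integral>\<^sup>+\<omega>. ennreal ((norm (z - v \<omega>))\<^sup>2) \<partial>M) < \<infinity>" .
      moreover have "\<phi> z * emeasure M (space M) < \<infinity>"
      proof (cases "finite_measure M")
        case True
        then have "emeasure M (space M) < \<infinity>"
          using finite_measure.emeasure_finite[OF True] by (simp add: less_top)
        then show ?thesis using z by (simp add: ennreal_mult_less_top less_top)
      next
        case False
        then show ?thesis using M by auto
      qed
      ultimately show ?thesis by simp
    qed
    finally show ?thesis .
  qed
  have "(\<lambda>m. \<integral>\<^sup>+\<omega>. Q \<omega> * indicator {\<omega>. m \<le> i \<omega>} \<omega> \<partial>M) \<longlonglongrightarrow> (\<integral>\<^sup>+\<omega>. 0 \<partial>M)"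
  proof (rule nn_integral_dominated_convergence[where w = Q])
    show "AE \<omega> in M. (\<lambda>m. Q \<omega> * indicator {\<omega>. m \<le> i \<omega>} \<omega>) \<longlonglongrightarrow> 0"
    proof (intro AE_I2 tendsto_eventually)
      fix \<omega>
      show "eventually (\<lambda>m. Q \<omega> * indicator {\<omega>. m \<le> i \<omega>} \<omega> = 0) sequentially"
        using eventually_gt_at_top[of "i \<omega>"] by eventually_elim (simp add: indicator_def)
    qed
  qed (use Q_fin in \<open>auto simp: indicator_def\<close>)
  then have "eventually (\<lambda>m. (\<integral>\<^sup>+\<omega>. Q \<omega> * indicator {\<omega>. m \<le> i \<omega>} \<omega> \<partial>M) < ennreal d) sequentially"
    using d by (intro order_tendstoD(2)) auto
  then obtain m where m: "(\<integral>\<^sup>+\<omega>. Q \<omega> * indicator {\<omega>. m \<le> i \<omega>} \<omega> \<partial>M) \<le> ennreal d"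
    by (meson eventually_happens' sequentially_bot less_imp_le)

  \<comment> \<open>Cells with \<open>\<phi> (a k)\<close> infinite are null by
    \<open>U_fin\<close>, so resetting them to \<open>z\<close> changes no integral and leaves only
    values at which \<open>\<phi>\<close> is finite.\<close>
  define b where "b k = (if k < m \<and> \<phi> (a k) \<noteq> \<infinity> then a k else z)" for k
  have V_close: "(\<integral>\<^sup>+\<omega>. ennreal ((norm (b (i \<omega>) - v \<omega>))\<^sup>2) \<partial>M) \<le> ennreal (2 * d)"
  proof -
    have "AE \<omega> in M. ennreal ((norm (b (i \<omega>) - v \<omega>))\<^sup>2)
        \<le> ennreal (4 * (c * h \<omega>)\<^sup>2) + Q \<omega> * indicator {\<omega>. m \<le> i \<omega>} \<omega>"
      using close U_fin
    proof eventually_elim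
      case (elim \<omega>)
      show ?case
      proof (cases "i \<omega> < m")
        case True
        have "(norm (a (i \<omega>) - v \<omega>))\<^sup>2 \<le> (2 * (c * h \<omega>))\<^sup>2"
          using elim by (intro power_mono) (auto simp: a_def dist_norm)
        then have "(norm (a (i \<omega>) - v \<omega>))\<^sup>2 \<le> 4 * (c * h \<omega>)\<^sup>2" by (simp add: power_mult_distrib)
        then show ?thesis using True elim by (simp add: b_def ennreal_leI)
      next
        case False
        then show ?thesis by (simp add: b_def Q_def add_increasing)
      qed
    qed
    then have "(\<integral>\<^sup>+\<omega>. ennreal ((norm (b (i \<omega>) - v \<omega>))\<^sup>2) \<partial>M)
        \<le> (\<integral>\<^sup>+\<omega>. ennreal (4 * (c * h \<omega>)\<^sup>2) + Q \<omega> * indicator {\<omega>. m \<le> i \<omega>} \<omega> \<partial>M)"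
      by (rule nn_integral_mono_AE)
    also have "\<dots> = ennreal (4 * c\<^sup>2 * I) + (\<integral>\<^sup>+\<omega>. Q \<omega> * indicator {\<omega>. m \<le> i \<omega>} \<omega> \<partial>M)"
      using g_int[of 4] by (subst nn_integral_add) auto
    also have "\<dots> \<le> ennreal d + ennreal d"
      using c m by (intro add_mono ennreal_leI)
    also have "\<dots> = ennreal (2 * d)"
      using d by (simp flip: ennreal_plus)
    finally show ?thesis .
  qed
  have V_le: "(\<integral>\<^sup>+\<omega>. \<phi> (b (i \<omega>)) \<partial>M) \<le> lift_fun M \<phi> v + ennreal d"
  proof -
    have "AE \<omega> in M. \<phi> (b (i \<omega>)) \<le> \<phi> (a (i \<omega>)) + Q \<omega> * indicator {\<omega>. m \<le> i \<omega>} \<omega>"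
      using U_fin
    proof eventually_elim
      case (elim \<omega>)
      show ?case
      proof (cases "i \<omega> < m")
        case True
        then show ?thesis using elim by (simp add: b_def)
      next
        case False
        then show ?thesis by (simp add: b_def Q_def add_increasing)
      qed
    qed
    then have "(\<integral>\<^sup>+\<omega>. \<phi> (b (i \<omega>)) \<partial>M) \<le> (\<integral>\<^sup>+\<omega>. \<phi> (a (i \<omega>)) + Q \<omega> * indicator {\<omega>. m \<le> i \<omega>} \<omega> \<partial>M)"
      by (rule nn_integral_mono_AE)
    also have "\<dots> = (\<integral>\<^sup>+\<omega>. \<phi> (a (i \<omega>)) \<partial>M) + (\<integral>\<^sup>+\<omega>. Q \<omega> * indicator {\<omega>. m \<le> i \<omega>} \<omega> \<partial>M)"
      by (intro nn_integral_add meas_\<phi>) measurable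
    also have "\<dots> \<le> lift_fun M \<phi> v + ennreal d"
      using U_le m by (intro add_mono) (simp_all add: lift_fun_def)
    finally show ?thesis .
  qed

  \<comment> \<open>\<open>F\<close> is the region where recovery may cause an error. For infinite
    measure only the finitely many cells below \<open>m\<close> count, because outside them
    \<open>b\<close> is 0.\<close>
  define F where "F = (if finite_measure M then space M else {\<omega> \<in> space M. i \<omega> < m})"
  have F [measurable]: "F \<in> sets M" by (simp add: F_def)
  have F_fin: "emeasure M F < \<infinity>"
  proof (cases "finite_measure M")
    case True
    then show ?thesis
      using finite_measure.emeasure_finite[OF True] by (simp add: less_top)
  next
    case False
    then have "F = (\<Union>k<m. i -` {k} \<inter> space M)" by (auto simp: F_def)
    then have "emeasure M F \<le> (\<Sum>k<m. emeasure M (i -` {k} \<inter> space M))"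
      using measurable_sets[OF i] by (simp only:) (rule emeasure_subadditive_finite, auto)
    also have "\<dots> < \<infinity>" using fin by simp
    finally show ?thesis .
  qed
  \<comment> \<open>A pointwise error \<open>\<eta>\<close> on \<open>F\<close> integrates to at
    most \<open>d\<close>; the summand 1 covers a null set \<open>F\<close>.\<close>
  define \<eta> where "\<eta> = d / (measure M F + 1)"
  have \<eta>: "\<eta> > 0" using d by (simp add: \<eta>_def add_nonneg_pos)
  have \<eta>F: "(\<integral>\<^sup>+\<omega>. ennreal \<eta> * indicator F \<omega> \<partial>M) \<le> ennreal d"
  proof -
    have "\<eta> * measure M F \<le> \<eta> * (measure M F + 1)" using \<eta> by simp
    also have "\<dots> = d"
      using add_nonneg_pos[OF measure_nonneg[of M F] zero_less_one] by (simp add: \<eta>_def)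
    finally show ?thesis
      using F_fin \<eta> by (simp add: nn_integral_cmult_indicator emeasure_eq_ennreal_measure ennreal_mult[symmetric] ennreal_leI)
  qed

  define X where "X = insert z {x \<in> a ` {..<m}. \<phi> x \<noteq> \<infinity>}"
  have "finite X" by (simp add: X_def)
  have b_X: "b k \<in> X" for k by (auto simp: b_def X_def)
  have "eventually (\<lambda>n. \<forall>x\<in>X. (norm (r x n - x))\<^sup>2 < \<eta> \<and> \<phi>s n (r x n) < \<phi> x + ennreal \<eta>) sequentially"
  proof (intro eventually_ball_finite[OF \<open>finite X\<close>] ballI eventually_conj)
    fix x assume "x \<in> X"
    then have "\<phi> x \<noteq> \<infinity>" using z by (auto simp: X_def)
    then have "\<phi> x < \<phi> x + ennreal \<eta>" using \<eta> by (cases "\<phi> x") (auto simp: ennreal_less_iff simp flip: ennreal_plus)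
    then show "eventually (\<lambda>n. \<phi>s n (r x n) < \<phi> x + ennreal \<eta>) sequentially"
      using r(2)[of x] by (intro Limsup_lessD) (rule le_less_trans)
    have "(\<lambda>n. (norm (r x n - x))\<^sup>2) \<longlonglongrightarrow> (norm (x - x))\<^sup>2"
      by (intro tendsto_intros r)
    then show "eventually (\<lambda>n. (norm (r x n - x))\<^sup>2 < \<eta>) sequentially"
      using \<eta> by (intro order_tendstoD(2)) auto
  qed
  then show ?thesis
  proof eventually_elim
    case (elim n)
    define w where "w \<omega> = r (b (i \<omega>)) n" for \<omega>
    have w [measurable]: "w \<in> borel_measurable M" unfolding w_def by measurable
    \<comment> \<open>Vacuous for finite measure, where \<open>F\<close> is the whole space.
      Otherwise \<open>z = 0\<close>, and 0 is its own recovery sequence.\<close>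
    have out: "b (i \<omega>) = 0 \<and> w \<omega> = 0 \<and> \<phi>s n (w \<omega>) = 0" if "\<omega> \<in> space M" "\<omega> \<notin> F" for \<omega>
      using that M by (auto simp: F_def b_def w_def split: if_splits)
    have "(\<integral>\<^sup>+\<omega>. ennreal ((norm (w \<omega> - v \<omega>))\<^sup>2) \<partial>M)
      \<le> (\<integral>\<^sup>+\<omega>. 2 * (ennreal \<eta> * indicator F \<omega>) + 2 * ennreal ((norm (b (i \<omega>) - v \<omega>))\<^sup>2) \<partial>M)"
    proof (rule nn_integral_mono)
      fix \<omega> assume \<omega>: "\<omega> \<in> space M"
      have "ennreal ((norm (w \<omega> - b (i \<omega>)))\<^sup>2) \<le> ennreal \<eta> * indicator F \<omega>"
        using out[OF \<omega>] elim b_X[of "i \<omega>"]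
        by (cases "\<omega> \<in> F") (auto simp: w_def less_imp_le intro!: ennreal_leI)
      then have le: "2 * ennreal ((norm (w \<omega> - b (i \<omega>)))\<^sup>2) + 2 * ennreal ((norm (b (i \<omega>) - v \<omega>))\<^sup>2)
          \<le> 2 * (ennreal \<eta> * indicator F \<omega>) + 2 * ennreal ((norm (b (i \<omega>) - v \<omega>))\<^sup>2)"
        by (intro add_right_mono mult_left_mono) auto
      have "ennreal ((norm (w \<omega> - v \<omega>))\<^sup>2)
          \<le> ennreal (2 * (norm (w \<omega> - b (i \<omega>)))\<^sup>2 + 2 * (norm (b (i \<omega>) - v \<omega>))\<^sup>2)"
        by (intro ennreal_leI norm_diff_power2_le)
      also have "\<dots> = 2 * ennreal ((norm (w \<omega> - b (i \<omega>)))\<^sup>2) + 2 * ennreal ((norm (b (i \<omega>) - v \<omega>))\<^sup>2)"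
        by (simp add: ennreal_mult)
      finally show "ennreal ((norm (w \<omega> - v \<omega>))\<^sup>2)
          \<le> 2 * (ennreal \<eta> * indicator F \<omega>) + 2 * ennreal ((norm (b (i \<omega>) - v \<omega>))\<^sup>2)"
        using le by (rule order_trans)
    qed
    also have "\<dots> = 2 * (\<integral>\<^sup>+\<omega>. ennreal \<eta> * indicator F \<omega> \<partial>M)
        + 2 * (\<integral>\<^sup>+\<omega>. ennreal ((norm (b (i \<omega>) - v \<omega>))\<^sup>2) \<partial>M)"
      by (subst nn_integral_add, measurable) (simp add: nn_integral_cmult)
    also have "\<dots> \<le> 2 * ennreal d + 2 * ennreal (2 * d)"
      by (intro add_mono mult_left_mono \<eta>F V_close) auto
    also have "\<dots> = ennreal (2 * d + 2 * (2 * d))"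
      using d by (subst ennreal_plus) (simp_all add: ennreal_mult)
    also have "\<dots> \<le> ennreal \<delta>"
      using \<delta> by (intro ennreal_leI) (simp add: d_def)
    finally have "w \<in> L2 M" "L2_inner M (w - v) (w - v) \<le> \<delta>"
      using L2_if_close[OF v w] \<delta> by auto
    moreover have "lift_fun M (\<phi>s n) w \<le> lift_fun M \<phi> v + ennreal \<delta>"
    proof -
      have "lift_fun M (\<phi>s n) w \<le> (\<integral>\<^sup>+\<omega>. \<phi> (b (i \<omega>)) + ennreal \<eta> * indicator F \<omega> \<partial>M)"
        unfolding lift_fun_def
      proof (rule nn_integral_mono)
        fix \<omega> assume \<omega>: "\<omega> \<in> space M"
        show "\<phi>s n (w \<omega>) \<le> \<phi> (b (i \<omega>)) + ennreal \<eta> * indicator F \<omega>"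
          using out[OF \<omega>] elim b_X[of "i \<omega>"]
          by (cases "\<omega> \<in> F") (auto simp: w_def intro: less_imp_le)
      qed
      also have "\<dots> = (\<integral>\<^sup>+\<omega>. \<phi> (b (i \<omega>)) \<partial>M) + (\<integral>\<^sup>+\<omega>. ennreal \<eta> * indicator F \<omega> \<partial>M)"
        by (intro nn_integral_add meas_\<phi>) measurable
      also have "\<dots> \<le> (lift_fun M \<phi> v + ennreal d) + ennreal d"
        by (intro add_mono V_le \<eta>F)
      also have "\<dots> = lift_fun M \<phi> v + ennreal (d + d)"
        using d by (subst ennreal_plus) (simp_all only: add.assoc less_imp_le)
      also have "\<dots> \<le> lift_fun M \<phi> v + ennreal \<delta>"
        using \<delta> by (intro add_left_mono ennreal_leI) (simp add: d_def)
      finally show ?thesis .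
    qed
    ultimately show ?case by blast
  qed
qed

text \<open>Diagonalize over the tolerances \<open>1 / Suc k\<close>, letting the tolerance used at
  \<open>n\<close> shrink as slowly as the thresholds require.\<close>

lemma recovery_sequence_if_eventually_approx:
  fixes \<psi>s :: "nat \<Rightarrow> ('w \<Rightarrow> 'h::{real_inner,banach,second_countable_topology}) \<Rightarrow> ennreal"
  assumes v: "v \<in> L2 M"
    and ap: "\<And>\<delta>. \<delta> > 0 \<Longrightarrow> eventually (\<lambda>n. \<exists>w\<in>L2 M. L2_inner M (w - v) (w - v) \<le> \<delta> \<and> \<psi>s n w \<le> C + ennreal \<delta>) sequentially"
  shows "\<exists>vs. (\<forall>n. vs n \<in> L2 M) \<and> strong_conv (L2 M) (L2_inner M) vs v \<and> limsup (\<lambda>n. \<psi>s n (vs n)) \<le> C"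
proof -
  define P where "P k n w \<longleftrightarrow> w \<in> L2 M \<and> L2_inner M (w - v) (w - v) \<le> 1 / Suc k \<and> \<psi>s n w \<le> C + ennreal (1 / Suc k)" for k n w
  have "eventually (\<lambda>n. \<exists>w. P k n w) sequentially" for k
    using ap[of "1 / Suc k"] by (auto simp: P_def Bex_def)
  then obtain \<kappa> :: "nat \<Rightarrow> nat" where \<kappa>: "filterlim \<kappa> at_top sequentially" "eventually (\<lambda>n. \<exists>w. P (\<kappa> n) n w) sequentially"
    by (rule diagonal_sequence[of "\<lambda>k n. \<exists>w. P k n w"])
  \<comment> \<open>The fallback \<open>v\<close> keeps every term in \<open>L2\<close>; it is used
    for at most finitely many \<open>n\<close>.\<close>
  define vs where "vs n = (if \<exists>w. P (\<kappa> n) n w then SOME w. P (\<kappa> n) n w else v)" for n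
  have ev: "eventually (\<lambda>n. P (\<kappa> n) n (vs n)) sequentially"
    using \<kappa>(2) by eventually_elim (simp add: vs_def someI_ex)
  have in_L2: "vs n \<in> L2 M" for n
  proof (cases "\<exists>w. P (\<kappa> n) n w")
    case True
    then have "P (\<kappa> n) n (vs n)" by (simp add: vs_def someI_ex)
    then show ?thesis by (simp add: P_def)
  qed (simp add: vs_def v)
  have lim: "(\<lambda>n. 1 / Suc (\<kappa> n)) \<longlonglongrightarrow> 0"
    using filterlim_compose[OF LIMSEQ_Suc[OF lim_1_over_n] \<kappa>(1)] .
  have "strong_conv (L2 M) (L2_inner M) vs v"
    unfolding strong_conv_def
  proof (rule tendsto_sandwich[OF _ _ tendsto_const lim])
    show "eventually (\<lambda>n. 0 \<le> L2_inner M (vs n - v) (vs n - v)) sequentially"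
      by (intro always_eventually allI) (simp add: L2_inner_def)
    show "eventually (\<lambda>n. L2_inner M (vs n - v) (vs n - v) \<le> 1 / Suc (\<kappa> n)) sequentially"
      using ev by eventually_elim (simp add: P_def)
  qed
  moreover have "limsup (\<lambda>n. \<psi>s n (vs n)) \<le> C"
  proof -
    have "limsup (\<lambda>n. \<psi>s n (vs n)) \<le> limsup (\<lambda>n. C + ennreal (1 / Suc (\<kappa> n)))"
      using ev by (intro Limsup_mono, eventually_elim) (simp add: P_def)
    also have "\<dots> = C + ennreal 0"
      by (intro lim_imp_Limsup tendsto_add tendsto_const tendsto_ennrealI lim) simp
    finally show ?thesis by simp
  qed
  ultimately show ?thesis using in_L2 by blast
qed

section \<open>Mosco convergence of the integral functionals\<close>

theorem theoremB4:
  fixes M :: "'w measure"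
    and \<phi>s :: "nat \<Rightarrow> 'h::{real_inner,banach,second_countable_topology} \<Rightarrow> ennreal"
    and \<phi> :: "'h \<Rightarrow> ennreal"
  assumes "complete_measure M"
    and "sigma_finite_measure M"
    and "\<And>n. proper_fun (\<phi>s n) \<and> lsc_fun (\<phi>s n) \<and> convex_fun (\<phi>s n)"
    and "proper_fun \<phi>" and "lsc_fun \<phi>" and "convex_fun \<phi>"
    and "condition_N (L2 M) (L2_inner M) (\<lambda>n. lift_fun M (\<phi>s n)) (lift_fun M \<phi>)
         \<or> finite_measure M"
    and "mosco UNIV inner \<phi>s \<phi>"
  shows "mosco (L2 M) (L2_inner M) (\<lambda>n. lift_fun M (\<phi>s n)) (lift_fun M \<phi>)"
proof -
  have liminf: "\<phi> x \<le> liminf (\<lambda>n. \<phi>s n (xs n))" if "weak_conv UNIV inner xs x" for xs x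
    using assms(8) that unfolding mosco_def by auto
  have "\<exists>xs. xs \<longlonglongrightarrow> x \<and> limsup (\<lambda>n. \<phi>s n (xs n)) \<le> \<phi> x" for x
  proof -
    obtain xs where xs: "strong_conv UNIV inner xs x" "limsup (\<lambda>n. \<phi>s n (xs n)) \<le> \<phi> x"
      using assms(8) unfolding mosco_def by blast
    then have "(\<lambda>n. sqrt ((norm (xs n - x))\<^sup>2)) \<longlonglongrightarrow> sqrt 0"
      unfolding strong_conv_def power2_norm_eq_inner by (intro tendsto_real_sqrt)
    then have "xs \<longlonglongrightarrow> x"
      by (simp add: tendsto_norm_zero_iff LIM_zero_iff)
    with xs(2) show ?thesis by blast
  qed
  then obtain r where r: "\<And>x. r x \<longlonglongrightarrow> x" "\<And>x. limsup (\<lambda>n. \<phi>s n (r x n)) \<le> \<phi> x"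
    by metis
  have "\<exists>vs. (\<forall>n. vs n \<in> L2 M) \<and> strong_conv (L2 M) (L2_inner M) vs v
      \<and> limsup (\<lambda>n. lift_fun M (\<phi>s n) (vs n)) \<le> lift_fun M \<phi> v" if v: "v \<in> L2 M" for v
  proof (cases "lift_fun M \<phi> v = \<infinity>")
    case True
    then show ?thesis
      using v by (intro exI[of _ "\<lambda>_. v"]) (simp add: strong_conv_def L2_inner_def)
  next
    case v_fin: False
    show ?thesis
    proof (rule recovery_sequence_if_eventually_approx[OF v])
      fix \<delta> :: real assume \<delta>: "\<delta> > 0"
      show "eventually (\<lambda>n. \<exists>w\<in>L2 M. L2_inner M (w - v) (w - v) \<le> \<delta> \<and>
          lift_fun M (\<phi>s n) w \<le> lift_fun M \<phi> v + ennreal \<delta>) sequentially"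
      proof (cases "finite_measure M")
        case True
        obtain z where "\<phi> z \<noteq> \<infinity>" using assms(4) by (auto simp: proper_fun_def)
        then show ?thesis
          using True by (intro lift_fun_eventually_approx[OF assms(2,4-6) r _ _ v v_fin \<delta>]) auto
      next
        case False
        \<comment> \<open>Condition (N) must hold in this case. Subgradients exist only where a
          functional is finite, so each integral functional has a point of finite value, and
          infinite measure forces \<open>\<phi>s n 0 = 0\<close>.\<close>
        then obtain us where us: "\<And>n. us n \<in> L2 M" "\<And>n. lift_fun M (\<phi>s n) (us n) \<noteq> \<infinity>"
          using assms(7) unfolding condition_N_def subdiff_def by auto
        have \<phi>s0: "\<phi>s n 0 = 0" for n
          using lsc_fun_zero_if_infinite_measure[OF _ us False] assms(3) by blast
        \<comment> \<open>The limit functional inherits the zero from the liminf inequality along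
          the constant sequence 0.\<close>
        have "\<phi> 0 \<le> liminf (\<lambda>n. \<phi>s n 0)"
          by (rule liminf) (simp add: weak_conv_def)
        then have \<phi>0: "\<phi> 0 = 0"
          by (simp add: \<phi>s0 Liminf_const)
        \<comment> \<open>Resetting the recovery sequence of 0 to the constant 0 is admissible
          because all functionals vanish there; this removes any error outside the finitely many
          cells.\<close>
        define r' where "r' = r(0 := \<lambda>_. 0)"
        have "r' x \<longlonglongrightarrow> x" "limsup (\<lambda>n. \<phi>s n (r' x n)) \<le> \<phi> x" for x
          using r[of x] by (auto simp: r'_def \<phi>s0 Limsup_const)
        then show ?thesis
          by (rule lift_fun_eventually_approx[OF assms(2,4-6), where z = 0])
            (use \<phi>0 \<phi>s0 v v_fin \<delta> in \<open>auto simp: r'_def\<close>)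
      qed
    qed
  qed
  moreover have "lift_fun M \<phi> u \<le> liminf (\<lambda>n. lift_fun M (\<phi>s n) (us n))"
    if "\<And>n. us n \<in> L2 M" "u \<in> L2 M" "weak_conv (L2 M) (L2_inner M) us u" for u us
    by (rule lift_fun_liminf[where \<phi>s = \<phi>s]) (use assms liminf that in auto)
  ultimately show ?thesis
    unfolding mosco_def by blast
qed

end
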